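(* Every art gallery with at most two reflex corners is normal.
   Context: An art gallery $\Gamma$ is a simple polygon in the plane (closed region: the boundary together with its interior), whose boundary is a simple closed curve made of finitely many line segments; the boundary is called the walls. A guard is a point of $\Gamma$. A guard $G$ visually covers a point $A\in\Gamma$ if the segment $GA$ is entirely contained in $\Gamma$ (touching the boundary is allowed). A configuration of guards is a finite set $F$ of points of $\Gamma$; it visually covers a set $X\subseteq\Gamma$ if every point of $X$ is visually covered by at least one guard of $F$. $\Gamma$ is normal if every configuration of guards that visually covers the walls of $\Gamma$ visually covers all of $\Gamma$. A reflex corner of $\Gamma$ is a corner at which the interior angle is greater than $180^\circ$. *)

theory Defs
  imports "HOL-Analysis.Analysis"
begin

definition edge :: "complex list \<Rightarrow> nat \<Rightarrow> complex set" where
  "edge p i = closed_segment (p ! i) (p ! (Suc i mod length p))"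

definition simple_polygon :: "complex list \<Rightarrow> bool" where
  "simple_polygon p \<longleftrightarrow> length p \<ge> 3 \<and> distinct p \<and>
     (\<forall>i<length p. \<forall>j<length p. i \<noteq> j \<longrightarrow>
        (if j = Suc i mod length p then edge p i \<inter> edge p j = {p ! j}
         else if i = Suc j mod length p then edge p i \<inter> edge p j = {p ! i}
         else edge p i \<inter> edge p j = {}))"

definition walls :: "complex list \<Rightarrow> complex set" where
  "walls p = (\<Union>i<length p. edge p i)"

definition gallery :: "complex list \<Rightarrow> complex set" where
  "gallery p = walls p \<union> inside (walls p)"

definition visually_covers :: "complex set \<Rightarrow> complex \<Rightarrow> complex \<Rightarrow> bool" where
  "visually_covers \<Gamma> G A \<longleftrightarrow> closed_segment G A \<subseteq> \<Gamma>"

definition config_covers :: "complex set \<Rightarrow> complex set \<Rightarrow> complex set \<Rightarrow> bool" where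
  "config_covers \<Gamma> F X \<longleftrightarrow> (\<forall>A\<in>X. \<exists>G\<in>F. visually_covers \<Gamma> G A)"

definition normal_gallery :: "complex list \<Rightarrow> bool" where
  "normal_gallery p \<longleftrightarrow>
     (\<forall>F. finite F \<and> F \<subseteq> gallery p \<and> config_covers (gallery p) F (walls p)
          \<longrightarrow> config_covers (gallery p) F (gallery p))"

definition interior_angle :: "complex list \<Rightarrow> nat \<Rightarrow> real" where
  "interior_angle p i = measure lebesgue
     {\<theta> \<in> {0..<2*pi}. \<exists>\<epsilon>>0. \<forall>t. 0 < t \<and> t < \<epsilon> \<longrightarrow>
         p ! i + complex_of_real t * cis \<theta> \<in> interior (gallery p)}"

definition reflex_corners :: "complex list \<Rightarrow> nat set" where
  "reflex_corners p = {i. i < length p \<and> interior_angle p i > pi}"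

end

theory Submission
  imports Defs
begin

text \<open>
  The gallery is compact and connected, has no holes, and is locally convex except at the reflex
  corners. Since there are no holes, a triangle whose sides lie in the gallery lies in it entirely.
  If \<open>G\<close> sees \<open>X\<close> and \<open>X\<close> sees \<open>Y\<close> but \<open>G\<close> does not see \<open>Y\<close>, then turning the line of sight of \<open>G\<close> along
  the segment \<open>X Y\<close> gets stuck at a point \<open>Z\<close> with a reflex corner other than \<open>G\<close> on the segment \<open>G Z\<close>.
  Hence a point that does not see everything sees a reflex corner other than itself.

  If some point \<open>R\<close> sees everything, then a guard who sees the end of the chord from \<open>R\<close> through \<open>A\<close> sees \<open>A\<close>.
  Otherwise there are two reflex corners \<open>R\<close>, \<open>R'\<close>, they see each other, and an uncovered point \<open>A\<close>, which
  may be moved off the line \<open>R R'\<close>, sees both. Some guard \<open>G'\<close> sees the end of the chord from \<open>R'\<close> through \<open>A\<close> and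
  is kept from seeing \<open>A\<close> by \<open>R\<close>. Extend the segment from \<open>A\<close> to the midpoint of \<open>R R'\<close> up to a wall point
  \<open>B\<close>, and let \<open>G\<close> be a guard who sees \<open>B\<close>; say \<open>R\<close> keeps \<open>G\<close> from seeing \<open>A\<close>. Near \<open>R\<close> the exterior is then met on
  both sides of the line \<open>G' R\<close>, whose part near \<open>R\<close> is in the gallery; but the exterior is convex near \<open>R\<close>.
\<close>

section \<open>Visibility in regions without holes\<close>

lemma point_on_segment:
  fixes a b :: complex
  assumes "0 \<le> t" "t \<le> 1"
  shows "a + t *\<^sub>R (b - a) \<in> closed_segment a b"
  unfolding closed_segment_def using assms by (auto simp: algebra_simps intro!: exI[of _ t])

lemma segment_pointE:
  fixes a b :: complex
  assumes "x \<in> closed_segment a b"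
  obtains t where "0 \<le> t" "t \<le> 1" "x = a + t *\<^sub>R (b - a)"
  using assms unfolding closed_segment_def by (auto simp: algebra_simps)

lemma closed_visible_from:
  fixes \<Gamma> :: "'a::real_normed_vector set"
  assumes "closed \<Gamma>"
  shows "closed {y. closed_segment G y \<subseteq> \<Gamma>}"
proof -
  have "{y. closed_segment G y \<subseteq> \<Gamma>} = (\<Inter>t\<in>{0..1}. (\<lambda>y. (1 - t) *\<^sub>R G + t *\<^sub>R y) -` \<Gamma>)"
    unfolding closed_segment_def by fastforce
  moreover have "closed ((\<lambda>y. (1 - t) *\<^sub>R G + t *\<^sub>R y) -` \<Gamma>)" for t
    by (rule continuous_closed_vimage[OF assms]) (intro continuous_intros)
  ultimately show ?thesis by auto
qed

lemma small_multiple: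
  fixes v :: "'a::real_normed_vector"
  assumes "r > 0"
  obtains t where "0 < t" "t \<le> 1" "t * norm v < r"
proof
  define t where "t = min 1 (r / (norm v + 1))"
  show "0 < t" "t \<le> 1" using assms by (auto simp: t_def add_nonneg_pos)
  have "t * norm v \<le> r / (norm v + 1) * norm v"
    by (intro mult_right_mono) (auto simp: t_def)
  also have "\<dots> = r * (norm v / (norm v + 1))" by simp
  also have "\<dots> < r * 1"
    using assms by (intro mult_strict_left_mono) (auto simp: divide_less_eq_1 add_nonneg_pos)
  finally show "t * norm v < r" by simp
qed

text \<open>Collects what the visibility argument uses of a gallery. Emptiness of
  \<open>inside \<Gamma>\<close> means that the complement has no bounded component. The points of
  \<open>S\<close> play the part of the reflex corners: there it is the exterior that is locally
  convex.\<close>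

locale hole_free_region =
  fixes \<Gamma> S :: "complex set"
  assumes compact: "compact \<Gamma>"
    and connected: "connected \<Gamma>"
    and hole_free: "inside \<Gamma> = {}"
    and star_at: "x \<in> \<Gamma> \<Longrightarrow> \<exists>r>0. \<forall>y\<in>\<Gamma> \<inter> ball x r. closed_segment x y \<subseteq> \<Gamma>"
    and convex_at: "x \<in> \<Gamma> \<Longrightarrow> x \<notin> S \<Longrightarrow> \<exists>r>0. convex (\<Gamma> \<inter> ball x r)"
    and reflex_at: "x \<in> S \<Longrightarrow> \<exists>r>0. convex (ball x r - \<Gamma>)"
begin

definition sees :: "complex \<Rightarrow> complex \<Rightarrow> bool" where
  "sees x y \<longleftrightarrow> closed_segment x y \<subseteq> \<Gamma>"

lemma sees_sym: "sees x y \<longleftrightarrow> sees y x"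
  by (simp add: sees_def closed_segment_commute)

lemma sees_mem: "sees x y \<Longrightarrow> x \<in> \<Gamma> \<and> y \<in> \<Gamma>"
  by (auto simp: sees_def)

lemma sees_refl: "x \<in> \<Gamma> \<Longrightarrow> sees x x"
  by (simp add: sees_def)

lemma sees_subsegment:
  "sees x y \<Longrightarrow> z \<in> closed_segment x y \<Longrightarrow> w \<in> closed_segment x y \<Longrightarrow> sees z w"
  unfolding sees_def by (meson closed_segment_subset convex_closed_segment subset_trans)

lemma sees_join:
  "sees x y \<Longrightarrow> sees y z \<Longrightarrow> y \<in> closed_segment x z \<Longrightarrow> sees x z"
  unfolding sees_def by (metis Un_closed_segment Un_subset_iff)

text \<open>A point of the triangle outside \<open>\<Gamma>\<close> lies in an unbounded component
  of the complement. That component must leave the triangle, hence meets a side, yet the sides lie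
  in \<open>\<Gamma>\<close>.\<close>

lemma triangle_subset:
  assumes "sees a b" "sees b c" "sees a c"
  shows "convex hull {a, b, c} \<subseteq> \<Gamma>"
proof
  let ?T = "convex hull {a, b, c}"
  fix x assume x: "x \<in> ?T"
  have fr: "frontier ?T \<subseteq> \<Gamma>"
    using assms by (simp add: frontier_of_triangle sees_def closed_segment_commute)
  show "x \<in> \<Gamma>"
  proof (rule ccontr)
    assume nx: "x \<notin> \<Gamma>"
    then have "x \<notin> inside \<Gamma>" using hole_free by simp
    then have unb: "\<not> bounded (connected_component_set (- \<Gamma>) x)"
      using nx by (simp add: inside_def)
    let ?C = "connected_component_set (- \<Gamma>) x"
    have "bounded ?T" by (simp add: bounded_convex_hull)
    then have "?C - ?T \<noteq> {}" using unb bounded_subset[of ?T ?C] by blast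
    moreover have "x \<in> ?C" using nx by simp
    then have "?C \<inter> ?T \<noteq> {}" using x by blast
    ultimately have "?C \<inter> frontier ?T \<noteq> {}"
      using connected_Int_frontier[of ?C ?T] by simp
    then show False using fr connected_component_subset[of "- \<Gamma>" x] by blast
  qed
qed

lemma sees_in_triangle:
  assumes "sees a b" "sees b c" "sees a c"
    and "x \<in> convex hull {a, b, c}" "y \<in> convex hull {a, b, c}"
  shows "sees x y"
  unfolding sees_def using triangle_subset[OF assms(1-3)] assms(4,5)
  by (meson closed_segment_subset convex_convex_hull subset_trans)

lemma sees_between:
  assumes "sees a b" "sees b c" "sees a c" "x \<in> closed_segment b c"
  shows "sees a x"
proof (rule sees_in_triangle[OF assms(1-3)])
  show "a \<in> convex hull {a, b, c}" by (simp add: hull_inc)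
  show "x \<in> convex hull {a, b, c}"
    using assms(4) hull_mono[of "{b, c}" "{a, b, c}" convex] by (auto simp: segment_convex_hull)
qed

text \<open>The ray from \<open>P\<close> through \<open>Q\<close> leaves the triangle \<open>W\<close>, \<open>Z\<close>, \<open>Z + \<delta>d\<close> through its side at \<open>Z\<close>.\<close>

lemma sees_past_side:
  assumes "sees W Z" "sees W (Z + \<delta> *\<^sub>R d)" "sees Z (Z + \<delta> *\<^sub>R d)"
    and "W = P + l *\<^sub>R (Z - P)" "0 < l" "l \<le> 1"
    and "Q = W + s *\<^sub>R (Z + \<delta> *\<^sub>R d - W)" "0 < s" "s \<le> 1" "0 < \<delta>"
    and "sees P Q"
  shows "\<exists>\<delta>'. 0 < \<delta>' \<and> \<delta>' \<le> \<delta> \<and> sees P (Z + \<delta>' *\<^sub>R d)"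
proof -
  \<comment> \<open>In \<open>Q - P\<close> the vector \<open>Z - P\<close> has coefficient
    \<open>m\<close> and \<open>d\<close> has coefficient \<open>s * \<delta>\<close>. Dividing by
    \<open>m\<close> gives the point \<open>E\<close> where the ray from \<open>P\<close> through
    \<open>Q\<close> meets the side at \<open>Z\<close>.\<close>
  define m where "m = l + s - s * l"
  have m: "s \<le> m" "0 < m" "m \<le> 1"
  proof -
    have "0 \<le> l * (1 - s)" using assms by (intro mult_nonneg_nonneg) auto
    then show "s \<le> m" by (simp add: m_def algebra_simps)
    then show "0 < m" using assms by linarith
    have "0 \<le> (1 - l) * (1 - s)" using assms by (intro mult_nonneg_nonneg) auto
    then show "m \<le> 1" by (simp add: m_def algebra_simps)
  qed
  define \<delta>' where "\<delta>' = s * \<delta> / m"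
  define E where "E = Z + \<delta>' *\<^sub>R d"
  have d: "0 < \<delta>'" "\<delta>' \<le> \<delta>" using m assms by (auto simp: \<delta>'_def field_simps)
  have "m * \<delta>' = s * \<delta>" using m by (simp add: \<delta>'_def)
  then have "Q = P + m *\<^sub>R (E - P)"
    unfolding E_def assms(7) assms(4)
    by (simp add: m_def algebra_simps flip: scaleR_add_left)
  then have QPE: "Q \<in> closed_segment P E" using m point_on_segment[of m P E] by simp
  let ?T = "convex hull {W, Z, Z + \<delta> *\<^sub>R d}"
  have "closed_segment W (Z + \<delta> *\<^sub>R d) \<subseteq> ?T" "closed_segment Z (Z + \<delta> *\<^sub>R d) \<subseteq> ?T"
    by (auto simp: segment_convex_hull intro: set_mp[OF hull_mono, rotated])
  moreover have "Q \<in> closed_segment W (Z + \<delta> *\<^sub>R d)"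
    using assms point_on_segment[of s W "Z + \<delta> *\<^sub>R d"] by simp
  moreover have "E \<in> closed_segment Z (Z + \<delta> *\<^sub>R d)"
    using d assms point_on_segment[of "\<delta>' / \<delta>" Z "Z + \<delta> *\<^sub>R d"] by (simp add: E_def)
  ultimately have "sees Q E"
    using sees_in_triangle[OF assms(1) assms(3) assms(2)] by blast
  then have "sees P E" using sees_join[OF assms(11) _ QPE] by simp
  then show ?thesis using d by (auto simp: E_def)
qed

text \<open>
  The parameters \<open>u\<close> for which \<open>G + u (Z - G)\<close> sees some point \<open>Z + \<delta>d\<close> form an interval ending at 1, and
  local convexity pushes its left end down to 0; at \<open>G\<close> itself being locally star-shaped suffices.
\<close>

lemma sees_opening:
  assumes GZ: "sees G Z" and S: "\<And>R. R \<in> S \<Longrightarrow> R \<in> closed_segment G Z \<Longrightarrow> R = G"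
    and Zd: "sees Z (Z + d)"
  shows "\<exists>\<delta>. 0 < \<delta> \<and> \<delta> \<le> 1 \<and> sees G (Z + \<delta> *\<^sub>R d)"
proof (cases "G = Z")
  case True
  then show ?thesis using Zd by (intro exI[of _ 1]) auto
next
  case False
  define W where "W u = G + u *\<^sub>R (Z - G)" for u
  define n where "n = norm (Z - G)"
  have n: "n > 0" using False by (simp add: n_def)
  have distW: "dist (W u) (W v) = \<bar>u - v\<bar> * n" for u v
    by (simp add: W_def dist_norm n_def flip: scaleR_diff_left)
  have Wseg: "0 \<le> u \<Longrightarrow> u \<le> 1 \<Longrightarrow> W u \<in> closed_segment G Z" for u
    by (simp add: W_def point_on_segment)
  have WinG: "0 \<le> u \<Longrightarrow> u \<le> 1 \<Longrightarrow> W u \<in> \<Gamma>" for u using Wseg GZ sees_def by blast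
  have WZ: "0 \<le> u \<Longrightarrow> u \<le> 1 \<Longrightarrow> sees (W u) Z" for u
    using sees_subsegment[OF GZ Wseg] by simp
  define I where "I = {u. 0 \<le> u \<and> u \<le> 1 \<and> (\<exists>\<delta>. 0 < \<delta> \<and> \<delta> \<le> 1 \<and> sees (W u) (Z + \<delta> *\<^sub>R d))}"
  have I1: "1 \<in> I" using Zd by (auto simp: I_def W_def intro!: exI[of _ 1])
  have bI: "bdd_below I" by (auto simp: I_def bdd_below_def)
  define u0 where "u0 = Inf I"
  have u0: "0 \<le> u0" "u0 \<le> 1"
    using I1 bI by (auto simp: u0_def I_def intro: cInf_lower intro!: cInf_greatest)
  \<comment> \<open>If \<open>u0 > 0\<close>, then \<open>W u0\<close> is not in \<open>S\<close>,
    and a convex neighbourhood gives a parameter \<open>u2\<close> below \<open>u0\<close>. If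
    \<open>u0 = 0\<close>, star-shapedness at \<open>G\<close> gives \<open>u2 = 0\<close>.\<close>
  obtain u2 r where u2: "0 \<le> u2" "u2 \<le> u0" "u2 < u0 \<or> u2 = 0" and r: "r > 0"
    and vis: "\<And>Q. Q \<in> \<Gamma> \<Longrightarrow> Q \<in> ball (W u0) r \<Longrightarrow> sees (W u2) Q"
  proof (cases "u0 = 0")
    case True
    have "G \<in> \<Gamma>" using GZ sees_mem by blast
    with star_at obtain r where "r > 0" "\<forall>y\<in>\<Gamma> \<inter> ball G r. closed_segment G y \<subseteq> \<Gamma>" by blast
    then show ?thesis using that[of 0 r] True by (auto simp: W_def sees_def)
  next
    case False
    then have "W u0 \<noteq> G" using \<open>G \<noteq> Z\<close> by (simp add: W_def)
    then have "W u0 \<notin> S" using S Wseg u0 by blast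
    with convex_at WinG u0 obtain r where r: "r > 0" "convex (\<Gamma> \<inter> ball (W u0) r)" by blast
    define u2 where "u2 = max 0 (u0 - r / (2 * n))"
    have u2: "0 \<le> u2" "u2 < u0" "u0 - u2 \<le> r / (2 * n)"
      using u0 False r n by (auto simp: u2_def)
    have "\<bar>u0 - u2\<bar> * n \<le> r / 2" using u2 n by (simp add: field_simps)
    then have "W u2 \<in> ball (W u0) r" using r by (simp add: distW)
    then have "W u2 \<in> \<Gamma> \<inter> ball (W u0) r" using WinG u2 u0 by simp
    then have "sees (W u2) Q" if "Q \<in> \<Gamma>" "Q \<in> ball (W u0) r" for Q
      using closed_segment_subset[OF _ _ r(2), of "W u2" Q] that by (auto simp: sees_def)
    then show ?thesis using that u2 r(1) by (meson less_imp_le)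
  qed
  \<comment> \<open>Some \<open>u1\<close> in \<open>I\<close> is close to \<open>u0\<close>. A
    point \<open>Q\<close> near \<open>W u0\<close> on the line of sight from \<open>W u1\<close> to
    \<open>Z + \<delta> *\<^sub>R d\<close> is seen from \<open>W u2\<close>, so
    \<open>sees_past_side\<close> applies. As \<open>u0\<close> is the infimum of \<open>I\<close>,
    this leaves only \<open>u2 = 0\<close>.\<close>
  have "u2 \<in> I"
  proof -
    have "Inf I < u0 + r / (2 * n)" using r n by (simp add: u0_def)
    then obtain u1 where u1: "u1 \<in> I" "u1 < u0 + r / (2 * n)"
      using cInf_less_iff[OF _ bI] I1 by blast
    have "u0 \<le> u1" using u1 bI by (simp add: u0_def cInf_lower)
    show ?thesis
    proof (cases "u1 = u2")
      case False
      with u2 \<open>u0 \<le> u1\<close> have lt: "u2 < u1" by simp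
      obtain \<delta> where \<delta>: "0 < \<delta>" "\<delta> \<le> 1" "sees (W u1) (Z + \<delta> *\<^sub>R d)" and u1': "0 \<le> u1" "u1 \<le> 1"
        using u1 by (auto simp: I_def)
      define l where "l = (u1 - u2) / (1 - u2)"
      have l: "0 < l" "l \<le> 1" using lt u1' by (auto simp: l_def)
      have l2: "l * (1 - u2) = u1 - u2" using lt u1' by (simp add: l_def)
      have W1: "W u1 = W u2 + l *\<^sub>R (Z - W u2)"
      proof -
        have "Z - W u2 = (1 - u2) *\<^sub>R (Z - G)" by (simp add: W_def algebra_simps)
        then have "l *\<^sub>R (Z - W u2) = (u1 - u2) *\<^sub>R (Z - G)" by (simp add: l2)
        then show ?thesis by (simp add: W_def algebra_simps)
      qed
      define v where "v = Z + \<delta> *\<^sub>R d - W u1"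
      obtain s where s: "0 < s" "s \<le> 1" and sv: "s * norm v < r / 2"
        using small_multiple[of "r / 2" v] r by auto
      define Q where "Q = W u1 + s *\<^sub>R v"
      have ZZ: "sees Z (Z + \<delta> *\<^sub>R d)"
        using sees_subsegment[OF Zd, of Z "Z + \<delta> *\<^sub>R d"] point_on_segment[of \<delta> Z "Z + d"] \<delta> by simp
      have "Q \<in> closed_segment (W u1) (Z + \<delta> *\<^sub>R d)"
        unfolding Q_def v_def using s by (intro point_on_segment) auto
      then have "Q \<in> \<Gamma>" using \<delta> by (auto simp: sees_def)
      moreover have "Q \<in> ball (W u0) r"
      proof -
        have "dist (W u0) (W u1) \<le> r / 2"
          using u1 \<open>u0 \<le> u1\<close> n by (simp add: distW field_simps)
        moreover have "dist (W u1) Q < r / 2" using sv s by (simp add: Q_def dist_norm)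
        ultimately show ?thesis using dist_triangle[of "W u0" Q "W u1"] by simp
      qed
      ultimately have "sees (W u2) Q" using vis by blast
      from sees_past_side[OF WZ \<delta>(3) ZZ W1 l _ s \<delta>(1) this] u1'
      obtain \<delta>' where "0 < \<delta>'" "\<delta>' \<le> \<delta>" "sees (W u2) (Z + \<delta>' *\<^sub>R d)"
        by (auto simp: Q_def v_def)
      then show ?thesis using \<delta> u2 u0 by (auto simp: I_def intro!: exI[of _ \<delta>'])
    qed (use u1 in simp)
  qed
  moreover have "\<not> u2 < u0" using \<open>u2 \<in> I\<close> bI by (simp add: u0_def cInf_lower not_less)
  ultimately have "0 \<in> I" using u2 by auto
  then show ?thesis by (simp add: I_def W_def)
qed

text \<open>\<open>Z\<close> is the last point of the segment from \<open>X\<close> to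
  \<open>Y\<close> that \<open>G\<close> sees; it exists because visibility is a closed condition.
  It is not \<open>Y\<close>, and if the line of sight to it met no point of \<open>S\<close> other
  than \<open>G\<close>, then \<open>sees_opening\<close> would give a visible point beyond
  it.\<close>

lemma blocked:
  assumes GX: "sees G X" and XY: "sees X Y" and n: "\<not> sees G Y"
  obtains Z R where "Z \<in> closed_segment X Y" "sees G Z" "R \<in> S" "R \<noteq> G" "R \<in> closed_segment G Z"
proof (rule ccontr)
  assume "\<not> thesis"
  then have no: "\<And>Z R. Z \<in> closed_segment X Y \<Longrightarrow> sees G Z \<Longrightarrow> R \<in> S \<Longrightarrow>
      R \<in> closed_segment G Z \<Longrightarrow> R = G"
    using that by blast
  define f where "f t = X + t *\<^sub>R (Y - X)" for t
  define T where "T = {0..1} \<inter> f -` {y. sees G y}"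
  have "closed (f -` {y. sees G y})"
    unfolding sees_def f_def
    by (rule continuous_closed_vimage[OF closed_visible_from]) 
       (use compact compact_imp_closed in \<open>auto intro!: continuous_intros\<close>)
  then have "Topological_Spaces.compact T" unfolding T_def by (intro compact_Int_closed) auto
  moreover have "0 \<in> T" using GX by (simp add: T_def f_def)
  ultimately obtain t where t: "t \<in> T" "\<And>s. s \<in> T \<Longrightarrow> s \<le> t"
    using compact_attains_sup[of T] by auto
  have "t \<noteq> 1" using t n by (auto simp: T_def f_def)
  then have t1: "0 \<le> t" "t < 1" "sees G (f t)" using t by (auto simp: T_def)
  define d where "d = (1 - t) *\<^sub>R (Y - X)"
  have ft: "f t \<in> closed_segment X Y" using t1 by (simp add: f_def point_on_segment)
  have "f t + d = Y" by (simp add: f_def d_def algebra_simps)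
  then have "sees (f t) (f t + d)" using sees_subsegment[OF XY ft] by simp
  moreover have "R = G" if "R \<in> S" "R \<in> closed_segment G (f t)" for R
    using no ft t1(3) that by blast
  ultimately obtain \<delta> where \<delta>: "0 < \<delta>" "\<delta> \<le> 1" "sees G (f t + \<delta> *\<^sub>R d)"
    using sees_opening[OF t1(3)] by blast
  have "f t + \<delta> *\<^sub>R d = f (t + \<delta> * (1 - t))" by (simp add: f_def d_def algebra_simps)
  moreover have "\<delta> * (1 - t) \<le> 1 * (1 - t)" using \<delta> t1 by (intro mult_right_mono) auto
  moreover have "t + \<delta> * (1 - t) \<le> 1" using calculation(2) by simp
  ultimately have "t + \<delta> * (1 - t) \<in> T" using \<delta> t1 by (simp add: T_def)
  then have "\<delta> * (1 - t) \<le> 0" using t(2) by force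
  then show False using \<delta> t1 by (simp add: mult_le_0_iff)
qed

text \<open>If \<open>x\<close> saw no such corner, the set \<open>V\<close> of points visible from
  \<open>x\<close> would be open in \<open>\<Gamma>\<close>, since an invisible point close to a
  visible one yields a corner by \<open>blocked\<close>. \<open>V\<close> is also closed, so
  connectedness would make it all of \<open>\<Gamma>\<close>.\<close>

lemma sees_reflex:
  assumes "x \<in> \<Gamma>" "y \<in> \<Gamma>" "\<not> sees x y"
  obtains R where "R \<in> S" "R \<noteq> x" "sees x R"
proof (rule ccontr)
  assume "\<not> thesis"
  then have no: "\<And>R. R \<in> S \<Longrightarrow> sees x R \<Longrightarrow> R = x" using that by blast
  define V where "V = \<Gamma> \<inter> {z. sees x z}"
  have "openin (top_of_set \<Gamma>) V"
    unfolding openin_euclidean_subtopology_iff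
  proof (intro conjI ballI)
    fix y assume y: "y \<in> V"
    then obtain r where r: "r > 0" "\<forall>z\<in>\<Gamma> \<inter> ball y r. closed_segment y z \<subseteq> \<Gamma>"
      using star_at[of y] by (auto simp: V_def)
    have "z \<in> V" if z: "z \<in> \<Gamma>" "dist z y < r" for z
    proof (rule ccontr)
      assume "z \<notin> V"
      then have "\<not> sees x z" using z by (simp add: V_def)
      moreover have "sees y z" using r z by (auto simp: sees_def dist_commute)
      moreover have "sees x y" using y by (simp add: V_def)
      ultimately obtain Z R where "R \<in> S" "R \<noteq> x" "R \<in> closed_segment x Z" "sees x Z"
        using blocked[of x y z] by metis
      then show False using no sees_subsegment[of x Z x R] by auto
    qed
    then show "\<exists>e>0. \<forall>x'\<in>\<Gamma>. dist x' y < e \<longrightarrow> x' \<in> V" using r by blast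
  qed (auto simp: V_def)
  moreover have "closedin (top_of_set \<Gamma>) V"
    unfolding V_def sees_def
    by (intro closedin_closed_Int closed_visible_from compact_imp_closed compact)
  moreover have "x \<in> V" using assms by (simp add: V_def sees_refl)
  ultimately have "V = \<Gamma>" using connected unfolding connected_clopen by blast
  then show False using assms by (auto simp: V_def)
qed

text \<open>\<open>B\<close> is the first frontier point on the ray from \<open>A\<close> away from
  \<open>P\<close>; before it the ray stays in the interior. \<open>P\<close> serves to fix the
  direction and may lie outside \<open>\<Gamma>\<close>.\<close>

lemma chord_to_frontier:
  assumes "A \<in> interior \<Gamma>" "A \<noteq> P"
  obtains B d where "B \<in> frontier \<Gamma>" "sees A B" "d > 0" "B = A + d *\<^sub>R (A - P)" "A \<in> closed_segment P B"
proof -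
  obtain d where d: "0 < d" "A + d *\<^sub>R (A - P) \<in> frontier \<Gamma>"
    "\<And>e. \<lbrakk>0 \<le> e; e < d\<rbrakk> \<Longrightarrow> A + e *\<^sub>R (A - P) \<in> interior \<Gamma>"
    using ray_to_frontier[OF compact_imp_bounded[OF compact] assms(1), of "A - P"] assms(2) by auto
  define B where "B = A + d *\<^sub>R (A - P)"
  have "x \<in> \<Gamma>" if "x \<in> closed_segment A B" for x
  proof -
    from that obtain t where t: "0 \<le> t" "t \<le> 1" "x = A + t *\<^sub>R (B - A)" by (rule segment_pointE)
    then have x: "x = A + (t * d) *\<^sub>R (A - P)" by (simp add: B_def)
    show ?thesis
    proof (cases "t = 1")
      case True
      then show ?thesis using d(2) x compact_imp_closed[OF compact] frontier_subset_closed by force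
    next
      case False
      then have "t * d < d" using t d(1) by simp
      then show ?thesis using d(3)[of "t * d"] t d(1) x interior_subset by auto
    qed
  qed
  then have "sees A B" by (auto simp: sees_def)
  moreover have "A \<in> closed_segment P B"
  proof -
    have "A = P + (1 / (1 + d)) *\<^sub>R (B - P)"
    proof -
      have "B - P = (1 + d) *\<^sub>R (A - P)" by (simp add: B_def algebra_simps)
      then show ?thesis using d(1) by simp
    qed
    then show ?thesis using d(1) point_on_segment[of "1 / (1 + d)" P B] by simp
  qed
  ultimately show ?thesis using that d B_def by blast
qed

end

section \<open>Coordinates around a reflex corner\<close>

lemma opposite_on_segment:
  fixes R Z :: complex
  assumes "s > 0"
  shows "R \<in> closed_segment (R - s *\<^sub>R (Z - R)) Z"
proof -
  let ?G = "R - s *\<^sub>R (Z - R)"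
  have "(s / (1 + s)) *\<^sub>R (Z - ?G) = s *\<^sub>R (Z - R)"
  proof -
    have "Z - ?G = (1 + s) *\<^sub>R (Z - R)" by (simp add: algebra_simps)
    then show ?thesis using assms by simp
  qed
  then have "R = ?G + (s / (1 + s)) *\<^sub>R (Z - ?G)" by simp
  then show ?thesis using point_on_segment[of "s / (1 + s)" ?G Z] assms by simp
qed

lemma opposite_of_between:
  fixes R Z :: complex
  assumes "R \<in> closed_segment G Z" "R \<noteq> G" "R \<noteq> Z"
  obtains s where "s > 0" "G = R - s *\<^sub>R (Z - R)"
proof -
  obtain t where t: "0 \<le> t" "t \<le> 1" "R = G + t *\<^sub>R (Z - G)"
    using assms(1) by (rule segment_pointE)
  have "t \<noteq> 0" "t \<noteq> 1" using t assms by auto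
  then have t': "0 < t" "t < 1" using t by auto
  have "Z - R = (1 - t) *\<^sub>R (Z - G)" unfolding t(3) by (simp add: algebra_simps)
  then have "(t / (1 - t)) *\<^sub>R (Z - R) = t *\<^sub>R (Z - G)" using t' by simp
  then have "G = R - (t / (1 - t)) *\<^sub>R (Z - R)" using t(3) by simp
  then show ?thesis using that[of "t / (1 - t)"] t' by simp
qed

text \<open>Stated for a pair of vectors because \<open>independent {p, q}\<close> would hold for
  equal nonzero \<open>p\<close> and \<open>q\<close>.\<close>

definition indep :: "complex \<Rightarrow> complex \<Rightarrow> bool" where
  "indep p q \<longleftrightarrow> (\<forall>x y. x *\<^sub>R p + y *\<^sub>R q = 0 \<longrightarrow> x = 0 \<and> y = 0)"

lemma indepD: "indep p q \<Longrightarrow> x *\<^sub>R p + y *\<^sub>R q = 0 \<Longrightarrow> x = 0 \<and> y = 0"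
  by (simp add: indep_def)

lemma indep_eqD:
  "indep p q \<Longrightarrow> x *\<^sub>R p + y *\<^sub>R q = x' *\<^sub>R p + y' *\<^sub>R q \<Longrightarrow> x = x' \<and> y = y'"
  using indepD[of p q "x - x'" "y - y'"] by (simp add: algebra_simps)

lemma segment_to_side_in_hull:
  assumes "R \<in> closed_segment a Z" "Z \<in> closed_segment b c"
  shows "R \<in> convex hull {a, b, c}"
proof -
  have "Z \<in> convex hull {a, b, c}"
    using assms(2) hull_mono[of "{b, c}" "{a, b, c}" convex] by (auto simp: segment_convex_hull)
  moreover have "a \<in> convex hull {a, b, c}" by (simp add: hull_inc)
  ultimately show ?thesis
    using assms(1) closed_segment_subset[OF _ _ convex_convex_hull] by blast
qed

lemma triangle_coordsE:
  fixes R :: complex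
  assumes "x \<in> convex hull {a, b, c}"
  obtains \<alpha> \<beta> \<gamma> where "\<alpha> \<ge> 0" "\<beta> \<ge> 0" "\<gamma> \<ge> 0" "\<alpha> + \<beta> + \<gamma> = 1"
    "x - R = \<alpha> *\<^sub>R (a - R) + \<beta> *\<^sub>R (b - R) + \<gamma> *\<^sub>R (c - R)"
proof -
  obtain \<alpha> \<beta> \<gamma> where *: "\<alpha> \<ge> 0" "\<beta> \<ge> 0" "\<gamma> \<ge> 0" "\<alpha> + \<beta> + \<gamma> = 1"
    "x = \<alpha> *\<^sub>R a + \<beta> *\<^sub>R b + \<gamma> *\<^sub>R c"
    using assms unfolding convex_hull_3 by blast
  have "x - R = x - (\<alpha> + \<beta> + \<gamma>) *\<^sub>R R" using * by simp
  also have "\<dots> = \<alpha> *\<^sub>R (a - R) + \<beta> *\<^sub>R (b - R) + \<gamma> *\<^sub>R (c - R)"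
    unfolding *(5) by (simp add: algebra_simps)
  finally show ?thesis using that * by blast
qed

context hole_free_region
begin

text \<open>Provides exterior points at every scale \<open>l\<close> in the angle at
  \<open>R\<close> between \<open>X\<close> and \<open>A\<close>, on the copy \<open>V W\<close> of
  the segment \<open>X A\<close> shrunk towards \<open>R\<close>. If that copy lay in
  \<open>\<Gamma>\<close>, then \<open>W\<close> would see \<open>X\<close> past \<open>V\<close>,
  and \<open>X\<close> would see \<open>A\<close> past \<open>W\<close>.\<close>

lemma reflex_shadow:
  assumes S: "S \<subseteq> {R, R'}" and XR: "sees X R" and RA: "sees R A" and XA: "\<not> sees X A"
    and ind: "indep (X - R) (A - R)" and R': "R' \<notin> convex hull {R, X, A}"
    and l: "0 < l" "l < 1"
  obtains w where "0 \<le> w" "w \<le> 1" "R + l *\<^sub>R ((1 - w) *\<^sub>R (X - R) + w *\<^sub>R (A - R)) \<notin> \<Gamma>"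
proof (rule ccontr)
  assume no: "\<not> thesis"
  define V where "V = R + l *\<^sub>R (X - R)"
  define W where "W = R + l *\<^sub>R (A - R)"
  have VW: "sees W V"
    unfolding sees_def
  proof
    fix x assume "x \<in> closed_segment W V"
    then obtain w where w: "0 \<le> w" "w \<le> 1" "x = W + w *\<^sub>R (V - W)" by (rule segment_pointE)
    then have "x = R + l *\<^sub>R ((1 - (1 - w)) *\<^sub>R (X - R) + (1 - w) *\<^sub>R (A - R))"
      by (simp add: V_def W_def algebra_simps)
    then show "x \<in> \<Gamma>" using no that[of "1 - w"] w by auto
  qed
  have Vs: "V \<in> closed_segment X R" 
    using l point_on_segment[of l R X] by (simp add: V_def closed_segment_commute)
  have Ws: "W \<in> closed_segment R A" using l point_on_segment[of l R A] by (simp add: W_def)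
  have VX: "sees V X" using sees_subsegment[OF XR Vs] by simp
  have WA: "sees W A" using sees_subsegment[OF RA Ws] by simp
  let ?T = "convex hull {R, X, A}"
  have vert: "R \<in> ?T" "X \<in> ?T" "A \<in> ?T" by (auto simp: hull_inc)
  then have VT: "V \<in> ?T" and WT: "W \<in> ?T"
    using Vs Ws closed_segment_subset[OF _ _ convex_convex_hull, of _ "{R, X, A}"] by blast+
  \<comment> \<open>A blocker lies in the triangle \<open>W V X\<close>, so it is not
    \<open>R'\<close> but \<open>R\<close>. By independence the barycentric coordinates of
    \<open>R\<close> would all vanish, although their sum is 1.\<close>
  have "sees W X"
  proof (rule ccontr)
    assume "\<not> sees W X"
    then obtain Z Q where Z: "Z \<in> closed_segment V X" "Q \<in> S" "Q \<in> closed_segment W Z"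
      using blocked[OF VW VX] by metis
    have Q: "Q \<in> convex hull {W, V, X}" using segment_to_side_in_hull Z by blast
    also have "\<dots> \<subseteq> ?T" using VT WT vert by (intro hull_minimal convex_convex_hull) auto
    finally have "Q = R" using Z S R' by blast
    then obtain \<alpha> \<beta> \<gamma> where c: "\<alpha> \<ge> 0" "\<beta> \<ge> 0" "\<gamma> \<ge> 0" "\<alpha> + \<beta> + \<gamma> = 1"
      "R - R = \<alpha> *\<^sub>R (W - R) + \<beta> *\<^sub>R (V - R) + \<gamma> *\<^sub>R (X - R)"
      using triangle_coordsE[OF Q, of R] by metis
    then have "(\<beta> * l + \<gamma>) *\<^sub>R (X - R) + (\<alpha> * l) *\<^sub>R (A - R) = 0"
      by (simp add: V_def W_def algebra_simps)
    from indepD[OF ind this] have "\<alpha> = 0" "\<beta> * l + \<gamma> = 0" using l by auto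
    moreover from this(2) have "\<beta> = 0" "\<gamma> = 0"
      using c l by (auto simp: add_nonneg_eq_0_iff)
    ultimately show False using c by simp
  qed
  moreover have "sees X A" if XW: "sees X W"
  proof (rule ccontr)
    assume "\<not> sees X A"
    then obtain Z Q where Z: "Z \<in> closed_segment W A" "Q \<in> S" "Q \<in> closed_segment X Z"
      using blocked[OF XW WA] by metis
    have Q: "Q \<in> convex hull {X, W, A}" using segment_to_side_in_hull Z by blast
    also have "\<dots> \<subseteq> ?T" using WT vert by (intro hull_minimal convex_convex_hull) auto
    finally have "Q = R" using Z S R' by blast
    then obtain \<alpha> \<beta> \<gamma> where c: "\<alpha> \<ge> 0" "\<beta> \<ge> 0" "\<gamma> \<ge> 0" "\<alpha> + \<beta> + \<gamma> = 1"
      "R - R = \<alpha> *\<^sub>R (X - R) + \<beta> *\<^sub>R (W - R) + \<gamma> *\<^sub>R (A - R)"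
      using triangle_coordsE[OF Q, of R] by metis
    then have "\<alpha> *\<^sub>R (X - R) + (\<beta> * l + \<gamma>) *\<^sub>R (A - R) = 0"
      by (simp add: W_def algebra_simps)
    from indepD[OF ind this] have "\<alpha> = 0" "\<beta> * l + \<gamma> = 0" by auto
    moreover from this(2) have "\<beta> = 0" "\<gamma> = 0"
      using c l by (auto simp: add_nonneg_eq_0_iff)
    ultimately show False using c by simp
  qed
  ultimately show False using XA sees_sym by blast
qed

text \<open>
  Points are written as \<open>R + x a + y b\<close>. The point \<open>Z'\<close> is the generic point beyond \<open>A\<close> on the ray from \<open>R'\<close>,
  and \<open>Z\<close> the generic point on the ray from \<open>A\<close> towards the midpoint of \<open>R\<close> and \<open>R'\<close>.
\<close>

lemma opposite_shadows_False:
  fixes R R' A a b :: complex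
  defines "a \<equiv> A - R" and "b \<equiv> R' - R"
  assumes R: "R \<in> S" and S: "S \<subseteq> {R, R'}" and ind: "indep a b"
    and RA: "sees R A" and RZ': "sees R Z'" and Z'A: "sees Z' A"
    and Z': "Z' = R + (t *\<^sub>R a - (t - 1) *\<^sub>R b)" "t > 1"
    and G': "G' = R - s *\<^sub>R (Z' - R)" "s > 0" "sees G' Z'" "\<not> sees G' A"
    and Z: "Z = R + ((1 - z) *\<^sub>R a + (z / 2) *\<^sub>R b)" "z > 0"
    and G: "G = R - g *\<^sub>R (Z - R)" "g > 0" "sees G Z" "\<not> sees G A"
  shows False
proof -
  have Gc: "G - R = (- g * (1 - z)) *\<^sub>R a + (- g * z / 2) *\<^sub>R b"
    unfolding G(1) Z(1) by (simp add: algebra_simps)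
  have Zc': "Z' - R = t *\<^sub>R a + (1 - t) *\<^sub>R b"
    unfolding Z'(1) by (simp add: algebra_simps)
  have Gc': "G' - R = (- s * t) *\<^sub>R a + (s * (t - 1)) *\<^sub>R b"
    unfolding G'(1) Z'(1) by (simp add: algebra_simps)
  have GR: "sees G R" using sees_subsegment[OF G(3), of G R] opposite_on_segment G by simp
  have GR': "sees G' R" using sees_subsegment[OF G'(3), of G' R] opposite_on_segment G' by simp
  have indG: "indep (G - R) (A - R)"
    unfolding indep_def
  proof (intro allI impI)
    fix x y assume "x *\<^sub>R (G - R) + y *\<^sub>R (A - R) = 0"
    then have "(y - x * g * (1 - z)) *\<^sub>R a + (- x * g * z / 2) *\<^sub>R b = 0"
      unfolding Gc by (simp add: a_def algebra_simps)
    from indepD[OF ind this] show "x = 0 \<and> y = 0" using G Z by auto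
  qed
  have indG': "indep (G' - R) (A - R)"
    unfolding indep_def
  proof (intro allI impI)
    fix x y assume "x *\<^sub>R (G' - R) + y *\<^sub>R (A - R) = 0"
    then have "(y - x * s * t) *\<^sub>R a + (x * s * (t - 1)) *\<^sub>R b = 0"
      unfolding Gc' by (simp add: a_def algebra_simps)
    from indepD[OF ind this] show "x = 0 \<and> y = 0" using G' Z' by auto
  qed
  \<comment> \<open>The coordinate along \<open>b\<close> is 1 at \<open>R'\<close>, but negative at
    \<open>G\<close> and zero at \<open>R\<close> and \<open>A\<close>.\<close>
  have R'G: "R' \<notin> convex hull {R, G, A}"
  proof
    assume "R' \<in> convex hull {R, G, A}"
    then obtain \<alpha> \<beta> \<gamma> where c: "\<beta> \<ge> 0" 
      "R' - R = \<alpha> *\<^sub>R (R - R) + \<beta> *\<^sub>R (G - R) + \<gamma> *\<^sub>R (A - R)"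
      using triangle_coordsE[of R' R G A R] by metis
    then have "0 *\<^sub>R a + 1 *\<^sub>R b = (\<gamma> - \<beta> * g * (1 - z)) *\<^sub>R a + (- \<beta> * g * z / 2) *\<^sub>R b"
      unfolding Gc by (simp add: a_def b_def algebra_simps)
    from indep_eqD[OF ind this] have "1 = - (\<beta> * g * z / 2)" by simp
    moreover have "\<beta> * g * z / 2 \<ge> 0" using c G Z by simp
    ultimately show False by linarith
  qed
  \<comment> \<open>Comparing coordinates forces the weight \<open>\<gamma>\<close> of
    \<open>A\<close> to be \<open>1 + \<beta> * s\<close>, which exceeds 1.\<close>
  have R'G': "R' \<notin> convex hull {R, G', A}"
  proof
    assume "R' \<in> convex hull {R, G', A}"
    then obtain \<alpha> \<beta> \<gamma> where c: "\<alpha> \<ge> 0" "\<beta> \<ge> 0" "\<gamma> \<ge> 0" "\<alpha> + \<beta> + \<gamma> = 1"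
      "R' - R = \<alpha> *\<^sub>R (R - R) + \<beta> *\<^sub>R (G' - R) + \<gamma> *\<^sub>R (A - R)"
      using triangle_coordsE[of R' R G' A R] by metis
    then have "0 *\<^sub>R a + 1 *\<^sub>R b = (\<gamma> - \<beta> * s * t) *\<^sub>R a + (\<beta> * s * (t - 1)) *\<^sub>R b"
      unfolding Gc' by (simp add: a_def b_def algebra_simps)
    from indep_eqD[OF ind this] have *: "\<gamma> = \<beta> * s * t" "\<beta> * s * (t - 1) = 1" by auto
    then have "\<gamma> = 1 + \<beta> * s" by (simp add: algebra_simps)
    moreover have "\<beta> * s > 0" using * c G' by (metis less_eq_real_def mult_nonneg_nonneg mult_zero_left zero_neq_one)
    ultimately show False using c by linarith
  qed
  obtain r0 where r0: "r0 > 0" "convex (ball R r0 - \<Gamma>)" using reflex_at R by blast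
  define n where "n = norm (Z' - R)"
  have "Z' \<noteq> R"
  proof
    assume "Z' = R"
    then have "t *\<^sub>R a + (1 - t) *\<^sub>R b = 0" using Zc' by simp
    from indepD[OF ind this] show False using Z' by simp
  qed
  then have n: "n > 0" by (simp add: n_def)
  \<comment> \<open>\<open>n\<close> and \<open>s * n\<close> are the distances from
    \<open>R\<close> to \<open>Z'\<close> and to \<open>G'\<close>, so a point of the line
    \<open>G' Z'\<close> in \<open>ball R r\<close> lies on the segment from \<open>G'\<close> to
    \<open>Z'\<close>.\<close>
  define r where "r = min r0 (min n (s * n))"
  have r: "r > 0" "r \<le> r0" "r \<le> n" "r \<le> s * n" using r0 n G' by (auto simp: r_def)
  have cvx: "convex (ball R r - \<Gamma>)"
  proof -
    have "ball R r - \<Gamma> = ball R r \<inter> (ball R r0 - \<Gamma>)" using r by auto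
    then show ?thesis using convex_Int[OF convex_ball r0(2)] by metis
  qed
  \<comment> \<open>The norms in \<open>K\<close> keep the exterior points found at scale
    \<open>l\<close> within \<open>ball R r\<close>; the remaining terms bound
    \<open>(\<kappa> + \<nu>) / l\<close> further down.\<close>
  define K where "K = 1 + g * z + g * z / 2 / (t - 1) + norm (G - R) + norm (G' - R) + norm (A - R)"
  have pos: "0 \<le> g * z" "0 \<le> g * z / 2 / (t - 1)" using G Z Z' by auto
  then have K: "K \<ge> 1" "norm (G - R) \<le> K" "norm (G' - R) \<le> K" "norm (A - R) \<le> K"
    "1 + g * z + g * z / 2 / (t - 1) \<le> K"
    by (auto simp: K_def)
  define l where "l = min 1 r / (2 * K)"
  have l: "l > 0" "l < 1" "l * K < 1" "l * K < r"
  proof -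
    have lK: "l * K = min 1 r / 2" using K by (simp add: l_def)
    show "l > 0" using r K by (simp add: l_def)
    show 1: "l * K < 1" "l * K < r" using lK r by auto
    have "l * 1 \<le> l * K" using \<open>l > 0\<close> K by (intro mult_left_mono) auto
    then show "l < 1" using 1 by simp
  qed
  have inball: "R + l *\<^sub>R ((1 - w) *\<^sub>R (X - R) + w *\<^sub>R (A - R)) \<in> ball R r"
    if w: "0 \<le> w" "w \<le> 1" and X: "norm (X - R) \<le> K" for w X
  proof -
    have "norm ((1 - w) *\<^sub>R (X - R) + w *\<^sub>R (A - R)) \<le> (1 - w) * norm (X - R) + w * norm (A - R)"
      using norm_triangle_ineq[of "(1 - w) *\<^sub>R (X - R)" "w *\<^sub>R (A - R)"] w by simp
    also have "\<dots> \<le> (1 - w) * K + w * K"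
      using w X K by (intro add_mono mult_left_mono) auto
    finally have "norm ((1 - w) *\<^sub>R (X - R) + w *\<^sub>R (A - R)) \<le> K" by (simp add: algebra_simps)
    then have "l * norm ((1 - w) *\<^sub>R (X - R) + w *\<^sub>R (A - R)) \<le> l * K"
      using l(1) by (rule mult_left_mono[OF _ less_imp_le])
    also have "\<dots> < r" using l(4) .
    finally show ?thesis using l(1) by (simp add: dist_norm)
  qed
  obtain w where w: "0 \<le> w" "w \<le> 1" and e1: "R + l *\<^sub>R ((1 - w) *\<^sub>R (G - R) + w *\<^sub>R (A - R)) \<notin> \<Gamma>"
    using reflex_shadow[OF S GR RA G(4) indG R'G l(1,2)] by blast
  obtain w' where w': "0 \<le> w'" "w' \<le> 1"
    and e1': "R + l *\<^sub>R ((1 - w') *\<^sub>R (G' - R) + w' *\<^sub>R (A - R)) \<notin> \<Gamma>"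
    using reflex_shadow[OF S GR' RA G'(4) indG' R'G' l(1,2)] by blast
  define e where "e = R + l *\<^sub>R ((1 - w) *\<^sub>R (G - R) + w *\<^sub>R (A - R))"
  define e' where "e' = R + l *\<^sub>R ((1 - w') *\<^sub>R (G' - R) + w' *\<^sub>R (A - R))"
  have mem: "e \<in> ball R r - \<Gamma>" "e' \<in> ball R r - \<Gamma>"
    using inball w w' K e1 e1' by (auto simp: e_def e'_def simp del: mem_ball)
  have comb: "l *\<^sub>R ((1 - w) *\<^sub>R (p *\<^sub>R a + q *\<^sub>R b) + w *\<^sub>R a)
      = (l * ((1 - w) * p + w)) *\<^sub>R a + (l * ((1 - w) * q)) *\<^sub>R b" for w p q
    by (simp add: scaleR_add_left scaleR_add_right distrib_left)
  \<comment> \<open>In vector form, \<open>e - R\<close> is \<open>l * w\<close> times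
    \<open>a\<close> minus \<open>x\<close> times \<open>Z - R\<close>; likewise for
    \<open>e'\<close> with \<open>w'\<close>, \<open>x'\<close> and \<open>Z'\<close>.\<close>
  define x where "x = l * (1 - w) * g"
  define ea where "ea = l * w - x * (1 - z)"
  define eb where "eb = - x * z / 2"
  define x' where "x' = l * (1 - w') * s"
  define ea' where "ea' = l * w' - x' * t"
  define eb' where "eb' = x' * (t - 1)"
  have ec: "e = R + (ea *\<^sub>R a + eb *\<^sub>R b)"
  proof -
    have c: "ea = l * ((1 - w) * (- g * (1 - z)) + w)" "eb = l * ((1 - w) * (- g * z / 2))"
      by (simp_all add: ea_def eb_def x_def field_simps)
    show ?thesis
      unfolding e_def Gc c a_def[symmetric] comb ..
  qed
  have ec': "e' = R + (ea' *\<^sub>R a + eb' *\<^sub>R b)"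
  proof -
    have c: "ea' = l * ((1 - w') * (- s * t) + w')" "eb' = l * ((1 - w') * (s * (t - 1)))"
      by (simp_all add: ea'_def eb'_def x'_def algebra_simps)
    show ?thesis
      unfolding e'_def Gc' c a_def[symmetric] comb ..
  qed
  \<comment> \<open>Otherwise \<open>e'\<close> would lie on the line of sight from
    \<open>G'\<close> to \<open>R\<close>.\<close>
  have "w' \<noteq> 0"
  proof
    assume "w' = 0"
    then have "e' = R + l *\<^sub>R (G' - R)" by (simp add: e'_def)
    then have "e' \<in> closed_segment G' R"
      using point_on_segment[of l R G'] l by (simp add: closed_segment_commute)
    then show False using mem GR' by (auto simp: sees_def)
  qed
  \<comment> \<open>The sign of \<open>t * y + (t - 1) * x\<close> tells on which side of the line G' R Z' the point
    \<open>R + x a + y b\<close> lies.\<close>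
  define \<phi> where "\<phi> = t * eb + (t - 1) * ea"
  define \<phi>' where "\<phi>' = t * eb' + (t - 1) * ea'"
  have "\<phi>' = (t - 1) * l * w'" by (simp add: \<phi>'_def ea'_def eb'_def algebra_simps)
  then have \<phi>': "\<phi>' > 0" using \<open>w' \<noteq> 0\<close> w' l Z' by simp
  have x0: "0 \<le> x" "x \<le> l * g"
    using w l G by (auto simp: x_def mult_le_cancel_right1 mult_le_cancel_left1)
  \<comment> \<open>Otherwise \<open>e - R\<close> is a combination of \<open>Z' - R\<close> and
    \<open>A - R\<close> with nonnegative coefficients \<open>\<kappa>\<close> and
    \<open>\<nu>\<close>, of sum at most 1 by the choice of \<open>l\<close>. Then \<open>e\<close>
    lies in the triangle \<open>R Z' A\<close>, which is part of \<open>\<Gamma>\<close>.\<close>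
  have \<phi>: "\<phi> < 0"
  proof (rule ccontr)
    assume n: "\<not> \<phi> < 0"
    define \<kappa> where "\<kappa> = (x * z / 2) / (t - 1)"
    define \<nu> where "\<nu> = \<phi> / (t - 1)"
    have \<kappa>0: "\<kappa> \<ge> 0" using x0 Z Z' by (simp add: \<kappa>_def)
    have \<nu>0: "\<nu> \<ge> 0" using n Z' by (simp add: \<nu>_def)
    have \<kappa>1: "\<kappa> * (t - 1) = - eb" 
    proof -
      have "y / (t - 1) * (t - 1) = y" for y using Z'(2) by simp
      then show ?thesis by (simp only: \<kappa>_def eb_def)
    qed
    have "\<nu> * (t - 1) = \<phi>" using Z' by (simp add: \<nu>_def)
    then have "(\<kappa> * t + \<nu>) * (t - 1) = ea * (t - 1)"
    proof -
      have "(\<kappa> * t + \<nu>) * (t - 1) = t * (\<kappa> * (t - 1)) + \<nu> * (t - 1)" by (simp add: algebra_simps)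
      also have "\<dots> = ea * (t - 1)" 
        unfolding \<kappa>1 \<open>\<nu> * (t - 1) = \<phi>\<close> \<phi>_def by (simp add: algebra_simps)
      finally show ?thesis .
    qed
    then have \<kappa>2: "\<kappa> * t + \<nu> = ea" using Z' by simp
    have "e = R + (\<kappa> *\<^sub>R (Z' - R) + \<nu> *\<^sub>R (A - R))"
    proof -
      have "\<kappa> *\<^sub>R (Z' - R) + \<nu> *\<^sub>R (A - R) = (\<kappa> * t + \<nu>) *\<^sub>R a - (\<kappa> * (t - 1)) *\<^sub>R b"
        unfolding Zc' by (simp add: a_def algebra_simps)
      also have "\<dots> = ea *\<^sub>R a + eb *\<^sub>R b" unfolding \<kappa>1 \<kappa>2 by simp
      finally show ?thesis using ec by simp
    qed
    then have e2: "e = (1 - \<kappa> - \<nu>) *\<^sub>R R + \<kappa> *\<^sub>R Z' + \<nu> *\<^sub>R A" by (simp add: algebra_simps)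
    have "\<kappa> \<le> l * (g * z / 2 / (t - 1))"
    proof -
      have "x * (z / 2 / (t - 1)) \<le> l * g * (z / 2 / (t - 1))"
        using x0 Z Z' by (intro mult_right_mono) auto
      then show ?thesis by (simp add: \<kappa>_def)
    qed
    moreover have "\<nu> \<le> l * (1 + g * z)"
    proof -
      have "\<nu> \<le> ea" using \<kappa>2 mult_nonneg_nonneg[OF \<kappa>0, of t] Z' by linarith
      also have "\<dots> \<le> l * 1 + x * z"
      proof -
        have "l * w \<le> l * 1" using l w by (intro mult_left_mono) auto
        then show ?thesis using x0 by (simp add: ea_def algebra_simps)
      qed
      also have "x * z \<le> l * g * z" using x0 Z by (intro mult_right_mono) auto
      finally show ?thesis by (simp add: algebra_simps)
    qed
    ultimately have "\<kappa> + \<nu> \<le> l * (1 + g * z + g * z / 2 / (t - 1))" by (simp add: algebra_simps)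
    also have "\<dots> \<le> l * K" using l K by (intro mult_left_mono) auto
    finally have "\<kappa> + \<nu> \<le> 1" using l by simp
    then have "e \<in> convex hull {R, Z', A}"
      unfolding convex_hull_3 mem_Collect_eq using e2 \<kappa>0 \<nu>0
      by (intro exI[of _ "1 - \<kappa> - \<nu>"] exI[of _ \<kappa>] exI[of _ \<nu>]) auto
    then show False using triangle_subset[OF RZ' Z'A RA] mem by blast
  qed
  \<comment> \<open>\<open>f\<close> is the point where the segment from \<open>e\<close> to
    \<open>e'\<close> crosses the line \<open>G' R Z'\<close>. It is exterior by convexity near
    \<open>R\<close>, but there this line runs in \<open>\<Gamma>\<close>.\<close>
  define q where "q = - \<phi> / (\<phi>' - \<phi>)"
  have q: "0 \<le> q" "q \<le> 1" "(1 - q) * \<phi> + q * \<phi>' = 0"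
  proof -
    have "q * (\<phi>' - \<phi>) = - \<phi>" using \<phi> \<phi>' by (simp add: q_def)
    then show "(1 - q) * \<phi> + q * \<phi>' = 0" by (simp add: algebra_simps)
  qed (use \<phi> \<phi>' in \<open>auto simp: q_def field_simps\<close>)
  define f where "f = (1 - q) *\<^sub>R e + q *\<^sub>R e'"
  have fm: "f \<in> ball R r - \<Gamma>"
    using cvx mem q unfolding f_def by (intro convexD_alt[OF cvx, of e e' q]) auto
  define fa where "fa = (1 - q) * ea + q * ea'"
  define fb where "fb = (1 - q) * eb + q * eb'"
  have fc: "f = R + (fa *\<^sub>R a + fb *\<^sub>R b)"
    unfolding f_def ec ec' fa_def fb_def by (simp add: algebra_simps)
  have "t * fb + (t - 1) * fa = 0"
    using q(3) by (simp add: \<phi>_def \<phi>'_def fa_def fb_def algebra_simps)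
  define c where "c = fa / t"
  have "fa = c * t" using Z' by (simp add: c_def)
  moreover have "fb = c * (1 - t)"
    using \<open>t * fb + (t - 1) * fa = 0\<close> Z' by (simp add: c_def field_simps)
  ultimately have fZ: "f = R + c *\<^sub>R (Z' - R)"
    unfolding fc Zc' by (simp add: scaleR_add_right)
  then have "\<bar>c\<bar> * n < r" using fm by (simp add: dist_norm n_def)
  then have "\<bar>c\<bar> * n < 1 * n" "\<bar>c\<bar> * n < s * n" using r by linarith+
  then have c: "\<bar>c\<bar> < 1" "\<bar>c\<bar> < s"
    using n by (simp_all only: mult_less_cancel_right_pos)
  define u where "u = (c + s) / (1 + s)"
  have "f = G' + u *\<^sub>R (Z' - G')"
  proof -
    have "Z' - G' = (1 + s) *\<^sub>R (Z' - R)" unfolding G'(1) by (simp add: algebra_simps)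
    then have "u *\<^sub>R (Z' - G') = (c + s) *\<^sub>R (Z' - R)" using G' by (simp add: u_def)
    then show ?thesis unfolding fZ G'(1) by (simp add: algebra_simps)
  qed
  moreover have "0 \<le> u" "u \<le> 1" using c G' by (auto simp: u_def)
  ultimately have "f \<in> closed_segment G' Z'" using point_on_segment by metis
  then show False using fm G' by (auto simp: sees_def)
qed

end

text \<open>The signed area of the parallelogram spanned by \<open>u\<close> and \<open>v\<close>,
  positive if \<open>v\<close> points to the left of \<open>u\<close>.\<close>

definition cross :: "complex \<Rightarrow> complex \<Rightarrow> real" where
  "cross u v = Re u * Im v - Im u * Re v"

lemma indep_cross:
  assumes "cross p q \<noteq> 0"
  shows "indep p q"
  unfolding indep_def
proof (intro allI impI)
  fix x y assume "x *\<^sub>R p + y *\<^sub>R q = 0"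
  then have *: "x * Re p + y * Re q = 0" "x * Im p + y * Im q = 0"
    by (auto simp: complex_eq_iff)
  have "x * cross p q = (x * Re p + y * Re q) * Im q - (x * Im p + y * Im q) * Re q"
    "y * cross p q = (x * Im p + y * Im q) * Re p - (x * Re p + y * Re q) * Im p"
    by (simp_all add: cross_def algebra_simps)
  then have "x * cross p q = 0" "y * cross p q = 0" unfolding * by simp_all
  then show "x = 0 \<and> y = 0" using assms by simp
qed

section \<open>From covering the frontier to covering the interior\<close>

context hole_free_region
begin

text \<open>Prolong the segment from \<open>R\<close> to \<open>A\<close> up to a frontier point
  \<open>B\<close>. A guard \<open>G\<close> who sees \<open>B\<close> is seen by \<open>R\<close>,
  so the triangle \<open>G R B\<close> lies in \<open>\<Gamma>\<close>, and \<open>A\<close> is on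
  its side \<open>R B\<close>.\<close>

lemma covered_if_kernel:
  assumes R: "R \<in> \<Gamma>" "\<And>y. y \<in> \<Gamma> \<Longrightarrow> sees R y"
    and F: "\<And>B. B \<in> frontier \<Gamma> \<Longrightarrow> \<exists>G\<in>F. sees G B"
    and A: "A \<in> interior \<Gamma>"
  shows "\<exists>G\<in>F. sees G A"
proof (cases "A = R")
  case True
  have "\<Gamma> \<noteq> UNIV" using compact compact_imp_bounded not_bounded_UNIV by metis
  then have "frontier \<Gamma> \<noteq> {}" using R frontier_eq_empty[of \<Gamma>] by blast
  then obtain G B where "G \<in> F" "sees G B" using F by blast
  then show ?thesis using R True sees_sym sees_mem by metis
next
  case False
  obtain B where B: "B \<in> frontier \<Gamma>" "sees A B" "A \<in> closed_segment R B"
    using chord_to_frontier[OF A False] by metis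
  obtain G where G: "G \<in> F" "sees G B" using F B by blast
  have "sees G R" "sees R B" using G B R sees_sym sees_mem by metis+
  then have "sees G A" using sees_between[OF _ _ G(2) B(3)] by simp
  then show ?thesis using G by blast
qed

text \<open>A guard \<open>G\<close> who sees the frontier point \<open>B\<close> beyond
  \<open>A\<close> cannot see \<open>R\<close>, since the triangle \<open>G R B\<close> would let
  \<open>G\<close> see \<open>A\<close>. So on the way from \<open>B\<close> back to
  \<open>A\<close> the sight of \<open>G\<close> is stopped by \<open>R'\<close>. As
  \<open>R'\<close> sees both \<open>R\<close> and \<open>Z\<close>, it also sees \<open>A\<close>
  between them.\<close>

lemma blocked_beyond:
  assumes S: "S \<subseteq> {R, R'}" and RR': "sees R R'"
    and F: "\<And>B. B \<in> frontier \<Gamma> \<Longrightarrow> \<exists>G\<in>F. sees G B" and n: "\<And>G. G \<in> F \<Longrightarrow> \<not> sees G A"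
    and A: "A \<in> interior \<Gamma>" "A \<noteq> R" "sees R A"
  obtains Z G d where "d > 0" "Z = A + d *\<^sub>R (A - R)" "sees A Z" "sees R' Z" "sees R' A"
    "sees G Z" "\<not> sees G A" "R' \<in> closed_segment G Z" "R' \<noteq> G"
proof -
  obtain B d where B: "B \<in> frontier \<Gamma>" "sees A B" "d > 0" "B = A + d *\<^sub>R (A - R)"
    "A \<in> closed_segment R B"
    using chord_to_frontier[OF A(1,2)] by metis
  have RB: "sees R B" using sees_join[OF A(3) B(2) B(5)] .
  obtain G where G: "G \<in> F" "sees G B" using F B by blast
  then have nG: "\<not> sees G A" using n by blast
  have nGR: "\<not> sees G R" using sees_between[OF _ RB G(2) B(5)] nG by blast
  have BA: "sees B A" using B sees_sym by blast
  obtain Z Q where Z: "Z \<in> closed_segment B A" "sees G Z" "Q \<in> S" "Q \<noteq> G" "Q \<in> closed_segment G Z"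
    using blocked[OF G(2) BA nG] by metis
  have "sees G Q" using sees_subsegment[OF Z(2) _ Z(5), of G] by simp
  then have Q: "Q = R'" using nGR Z S by auto
  have R'Z: "sees R' Z" using sees_subsegment[OF Z(2) Z(5), of Z] Q by simp
  have AZ: "sees A Z" using sees_subsegment[OF BA _ Z(1), of A] by simp
  have "Z \<noteq> A" using Z nG by auto
  obtain t where t: "0 \<le> t" "t \<le> 1" "Z = A + t *\<^sub>R (B - A)"
    using Z(1) segment_pointE by (metis closed_segment_commute)
  then have "t \<noteq> 0" using \<open>Z \<noteq> A\<close> by auto
  then have d': "0 < t * d" "Z = A + (t * d) *\<^sub>R (A - R)" using t B by auto
  have "A \<in> closed_segment R Z"
  proof -
    have "R = A - (1 / (t * d)) *\<^sub>R (Z - A)" using d' by auto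
    then show ?thesis using opposite_on_segment[of "1 / (t * d)" A Z] d'(1) by simp
  qed
  moreover have "sees R Z" using sees_join[OF A(3) AZ \<open>A \<in> closed_segment R Z\<close>] .
  ultimately have "sees R' A" using sees_between[of R' R Z A] RR' R'Z sees_sym by blast
  then show ?thesis using that[OF d' AZ R'Z _ Z(2) nG] Z Q by blast
qed

text \<open>Translates two guards blocked by the same corner \<open>R\<close> into the coordinates
  of \<open>opposite_shadows_False\<close>, with \<open>1 + d\<close> for its \<open>t\<close>.
  Independence keeps \<open>R\<close> apart from \<open>Z\<close> and \<open>Z'\<close>, so each
  guard lies opposite its target.\<close>

lemma two_reflex_blocked_False:
  assumes R: "R \<in> S" and S: "S \<subseteq> {R, R'}" and ind: "indep (A - R) (R' - R)" and RA: "sees R A"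
    and Z': "d > 0" "Z' = A + d *\<^sub>R (A - R')" "sees A Z'" "sees R Z'"
    and G': "sees G' Z'" "\<not> sees G' A" "R \<in> closed_segment G' Z'" "R \<noteq> G'"
    and Z: "Z = A + z *\<^sub>R ((1/2) *\<^sub>R (R + R') - A)" "z > 0"
    and G: "sees G Z" "\<not> sees G A" "R \<in> closed_segment G Z" "R \<noteq> G"
  shows False
proof -
  have Zc: "Z = R + ((1 - z) *\<^sub>R (A - R) + (z / 2) *\<^sub>R (R' - R))"
    by (simp add: Z(1) complex_eq_iff field_simps)
  have Zc': "Z' = R + ((1 + d) *\<^sub>R (A - R) - (1 + d - 1) *\<^sub>R (R' - R))"
    by (simp add: Z'(2) algebra_simps)
  have "R \<noteq> Z"
  proof
    assume "R = Z"
    then have "(1 - z) *\<^sub>R (A - R) + (z / 2) *\<^sub>R (R' - R) = 0" using Zc by simp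
    from indepD[OF ind this] show False using Z by simp
  qed
  then obtain g where g: "g > 0" "G = R - g *\<^sub>R (Z - R)"
    using opposite_of_between G by metis
  have "R \<noteq> Z'"
  proof
    assume "R = Z'"
    then have "(1 + d) *\<^sub>R (A - R) + (- d) *\<^sub>R (R' - R) = 0" using Zc' by simp
    from indepD[OF ind this] show False using Z' by simp
  qed
  then obtain s where s: "s > 0" "G' = R - s *\<^sub>R (Z' - R)"
    using opposite_of_between G' by metis
  have "sees Z' A" using Z' sees_sym by blast
  show False
    using opposite_shadows_False[OF R S ind RA Z'(4) \<open>sees Z' A\<close> Zc' _ s(2,1) G'(1,2) Zc Z(2) g(2,1) G(1,2)]
      Z'(1) by simp
qed

lemma covered_if_two_reflex:
  assumes S: "S = {R, R'}" and RR': "sees R R'" and cr: "cross (A - R) (R' - R) \<noteq> 0"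
    and F: "\<And>B. B \<in> frontier \<Gamma> \<Longrightarrow> \<exists>G\<in>F. sees G B"
    and A: "A \<in> interior \<Gamma>"
  shows "\<exists>G\<in>F. sees G A"
proof (rule ccontr)
  assume "\<not> ?thesis"
  then have n: "\<And>G. G \<in> F \<Longrightarrow> \<not> sees G A" by blast
  have ind: "indep (A - R) (R' - R)" by (rule indep_cross[OF cr])
  have "cross (A - R') (R - R') = - cross (A - R) (R' - R)" by (simp add: cross_def algebra_simps)
  then have ind': "indep (A - R') (R - R')" using cr by (intro indep_cross) simp
  have ne: "A \<noteq> R" "A \<noteq> R'" using cr by (auto simp: cross_def algebra_simps)
  have S1: "S \<subseteq> {R, R'}" "S \<subseteq> {R', R}" using S by auto
  have RR2: "sees R' R" using RR' sees_sym by blast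
  have AG: "A \<in> \<Gamma>" using A interior_subset by blast
  have "sees R A \<or> sees R' A"
  proof (rule ccontr)
    assume no: "\<not> ?thesis"
    then have "\<not> sees A R" using sees_sym by blast
    then obtain Q where "Q \<in> S" "sees A Q"
      using sees_reflex[of A R] AG RR' sees_mem by metis
    then show False using S no sees_sym by auto
  qed
  \<comment> \<open>By \<open>blocked_beyond\<close>, an uncovered point that sees one of the
    corners also sees the other.\<close>
  then have RA: "sees R A" and R'A: "sees R' A"
    using blocked_beyond[OF S1(1) RR' F n A ne(1)] blocked_beyond[OF S1(2) RR2 F n A ne(2)]
    by metis+
  obtain Z1 G1 d1 where 1: "d1 > 0" "Z1 = A + d1 *\<^sub>R (A - R)" "sees A Z1" "sees R' Z1"
    "sees G1 Z1" "\<not> sees G1 A" "R' \<in> closed_segment G1 Z1" "R' \<noteq> G1"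
    using blocked_beyond[OF S1(1) RR' F n A ne(1) RA] by metis
  obtain Z2 G2 d2 where 2: "d2 > 0" "Z2 = A + d2 *\<^sub>R (A - R')" "sees A Z2" "sees R Z2"
    "sees G2 Z2" "\<not> sees G2 A" "R \<in> closed_segment G2 Z2" "R \<noteq> G2"
    using blocked_beyond[OF S1(2) RR2 F n A ne(2) R'A] by metis
  define M where "M = (1/2) *\<^sub>R (R + R')"
  have "A \<noteq> M"
  proof
    assume "A = M"
    then have "A - R = (1/2) *\<^sub>R (R' - R)" by (simp add: M_def complex_eq_iff field_simps)
    then show False using cr by (simp add: cross_def)
  qed
  \<comment> \<open>\<open>chord_to_frontier\<close> moves away from its \<open>P\<close>; the
    reflection of \<open>M\<close> in \<open>A\<close> as \<open>P\<close> makes the ray run towards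
    \<open>M\<close>.\<close>
  then have "A \<noteq> A + (A - M)" by simp
  then obtain B d where B: "B \<in> frontier \<Gamma>" "sees A B" "d > 0" "B = A + d *\<^sub>R (A - (A + (A - M)))"
    using chord_to_frontier[OF A] by metis
  obtain G where G: "G \<in> F" "sees G B" using F B by blast
  then have nG: "\<not> sees G A" using n by blast
  have BA: "sees B A" using B sees_sym by blast
  obtain Z Q where Z: "Z \<in> closed_segment B A" "sees G Z" "Q \<in> S" "Q \<noteq> G" "Q \<in> closed_segment G Z"
    using blocked[OF G(2) BA nG] by metis
  have "Z \<noteq> A" using Z nG by auto
  obtain t where t: "0 \<le> t" "t \<le> 1" "Z = A + t *\<^sub>R (B - A)"
    using Z(1) segment_pointE by (metis closed_segment_commute)
  then have "t \<noteq> 0" using \<open>Z \<noteq> A\<close> by auto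
  then have z: "0 < t * d" "Z = A + (t * d) *\<^sub>R (M - A)" using t B by auto
  have z': "Z = A + (t * d) *\<^sub>R ((1/2) *\<^sub>R (R + R') - A)" "Z = A + (t * d) *\<^sub>R ((1/2) *\<^sub>R (R' + R) - A)"
    using z(2) by (simp_all add: M_def add.commute)
  have RS: "R \<in> S" "R' \<in> S" using S by auto
  \<comment> \<open>Whichever corner blocks \<open>G\<close>, one of the guards \<open>G1\<close>
    and \<open>G2\<close> is blocked by the same corner.\<close>
  consider "Q = R" | "Q = R'" using Z S by blast
  then show False
  proof cases
    case 1
    show ?thesis
      using two_reflex_blocked_False[OF RS(1) S1(1) ind RA 2(1,2,3,4,5,6,7,8) z'(1) z(1) Z(2) nG] Z 1
      by blast
  next
    case Q: 2
    show ?thesis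
      using two_reflex_blocked_False[OF RS(2) S1(2) ind' R'A 1(1,2,3,4,5,6,7,8) z'(2) z(1) Z(2) nG] Z Q
      by blast
  qed
qed

text \<open>If no point sees everything, \<open>sees_reflex\<close> leads from \<open>A\<close> to a
  point \<open>R\<close> of \<open>S\<close> and from \<open>R\<close> to another point
  \<open>R'\<close> of \<open>S\<close>, and these two exhaust \<open>S\<close>.\<close>

theorem covered_interior:
  assumes S: "finite S" "card S \<le> 2" and fin: "finite F"
    and F: "\<And>B. B \<in> frontier \<Gamma> \<Longrightarrow> \<exists>G\<in>F. sees G B"
    and A: "A \<in> interior \<Gamma>"
  shows "\<exists>G\<in>F. sees G A"
proof (cases "\<exists>R\<in>\<Gamma>. \<forall>y\<in>\<Gamma>. sees R y")
  case True
  then show ?thesis using covered_if_kernel[OF _ _ F A] by blast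
next
  case False
  then have all: "\<exists>R\<in>S. R \<noteq> x \<and> sees x R" if "x \<in> \<Gamma>" for x
    using that sees_reflex by metis
  have AG: "A \<in> \<Gamma>" using A interior_subset by blast
  obtain R where R: "R \<in> S" "sees A R" using all[OF AG] by blast
  then obtain R' where R': "R' \<in> S" "R' \<noteq> R" "sees R R'" using all sees_mem by blast
  have SR: "S = {R, R'}"
  proof -
    have "{R, R'} \<subseteq> S" "card {R, R'} = 2" using R R' by auto
    then show ?thesis using card_seteq[OF S(1), of "{R, R'}"] S(2) by simp
  qed
  show ?thesis
  proof (rule ccontr)
    assume n: "\<not> ?thesis"
    \<comment> \<open>With finitely many guards the uncovered interior points form an open set, so
      \<open>A\<close> can be moved off the line \<open>R R'\<close> within it.\<close>
    define U where "U = interior \<Gamma> - (\<Union>G\<in>F. {y. sees G y})"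
    have "closed {y. sees G y}" for G
      unfolding sees_def by (intro closed_visible_from compact_imp_closed compact)
    then have "open U" unfolding U_def using fin by (intro open_Diff closed_UN) auto
    moreover have "A \<in> U" using A n by (auto simp: U_def)
    ultimately obtain \<epsilon> where \<epsilon>: "\<epsilon> > 0" "ball A \<epsilon> \<subseteq> U" using open_contains_ball by blast
    define b where "b = R' - R"
    have b: "norm b > 0" using R' by (simp add: b_def)
    obtain A' where A': "A' \<in> U" "cross (A' - R) (R' - R) \<noteq> 0"
    proof (cases "cross (A - R) (R' - R) = 0")
      case True
      define \<delta> where "\<delta> = \<epsilon> / (2 * norm b)"
      have \<delta>: "\<delta> > 0" "\<delta> * norm b < \<epsilon>" using \<epsilon> b by (auto simp: \<delta>_def)
      \<comment> \<open>Moving perpendicularly to \<open>b\<close> changes the cross product by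
        \<open>- \<delta> * (norm b)\<^sup>2\<close>.\<close>
      define A' where "A' = A + \<delta> *\<^sub>R (\<i> * b)"
      have "dist A A' = \<delta> * norm b" using \<delta> by (simp add: A'_def dist_norm norm_mult)
      then have "A' \<in> U" using \<epsilon> \<delta> by auto
      moreover have "cross (A' - R) b = cross (A - R) b - \<delta> * (norm b)\<^sup>2"
        unfolding cmod_power2 by (simp add: cross_def A'_def algebra_simps power2_eq_square)
      then have "cross (A' - R) (R' - R) \<noteq> 0" using True \<delta> b by (simp add: b_def)
      ultimately show ?thesis using that by blast
    qed (use that \<open>A \<in> U\<close> in blast)
    then have "\<exists>G\<in>F. sees G A'"
      using covered_if_two_reflex[OF SR R'(3) A'(2) F] by (auto simp: U_def)
    then show False using A' by (auto simp: U_def)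
  qed
qed

end

section \<open>The shape of a region near a bend of its boundary\<close>

lemma cross_simps:
  "cross u 0 = 0" "cross 0 v = 0" "cross u u = 0"
  "cross u (v + w) = cross u v + cross u w" "cross (u + v) w = cross u w + cross v w"
  "cross u (v - w) = cross u v - cross u w" "cross (u - v) w = cross u w - cross v w"
  "cross u (t *\<^sub>R v) = t * cross u v" "cross (t *\<^sub>R u) v = t * cross u v"
  "cross (- u) v = - cross u v" "cross u (- v) = - cross u v"
  by (simp_all add: cross_def algebra_simps)

text \<open>Cramer's rule for \<open>w\<close> in the basis \<open>u\<close>, \<open>v\<close>, with
  the denominator cleared.\<close>

lemma cross_decompose: "cross u v *\<^sub>R w = cross w v *\<^sub>R u + cross u w *\<^sub>R v"
  by (simp add: cross_def complex_eq_iff algebra_simps)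

lemma cross_linear_left: "linear (\<lambda>w. cross w v)"
  by (rule linearI) (auto simp: cross_simps)

lemma cross_linear_right: "linear (\<lambda>w. cross u w)"
  by (rule linearI) (auto simp: cross_simps)

lemma continuous_on_cross [continuous_intros]:
  "continuous_on A f \<Longrightarrow> continuous_on A g \<Longrightarrow> continuous_on A (\<lambda>x. cross (f x) (g x))"
  unfolding cross_def by (intro continuous_intros)

lemma convex_halfplane_at:
  fixes x :: complex
  assumes "linear (f :: complex \<Rightarrow> real)"
  shows "convex {z. f (z - x) < 0}" "convex {z. f (z - x) > 0}"
    "convex {z. f (z - x) \<le> 0}" "convex {z. f (z - x) \<ge> 0}"
proof -
  have *: "{z. f (z - x) < 0} = f -` {..<f x}" "{z. f (z - x) > 0} = f -` {f x<..}"
    "{z. f (z - x) \<le> 0} = f -` {..f x}" "{z. f (z - x) \<ge> 0} = f -` {f x..}"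
    using linear_diff[OF assms] by auto
  show "convex {z. f (z - x) < 0}" "convex {z. f (z - x) > 0}"
    "convex {z. f (z - x) \<le> 0}" "convex {z. f (z - x) \<ge> 0}"
    unfolding * by (intro convex_linear_vimage[OF assms] convex_real_interval)+
qed

text \<open>For \<open>cross u v > 0\<close> the inequalities say that both coordinates of
  \<open>z - x\<close> in the basis \<open>u\<close>, \<open>v\<close> are positive: this is the
  open angle at \<open>x\<close> counterclockwise from \<open>u\<close> to \<open>v\<close>.\<close>

definition sector :: "complex \<Rightarrow> complex \<Rightarrow> complex \<Rightarrow> complex set" where
  "sector x u v = {z. cross (z - x) v > 0 \<and> cross u (z - x) > 0}"

lemma convex_sector: "convex (sector x u v)"
proof -
  have "sector x u v = {z. cross (z - x) v > 0} \<inter> {z. cross u (z - x) > 0}"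
    by (auto simp: sector_def)
  then show ?thesis
    using convex_Int[OF convex_halfplane_at(2)[OF cross_linear_left] convex_halfplane_at(2)[OF cross_linear_right]]
    by simp
qed

lemma sector_dilate:
  "t > 0 \<Longrightarrow> x + t *\<^sub>R w \<in> sector x u v \<longleftrightarrow> x + w \<in> sector x u v"
  by (simp add: sector_def cross_simps zero_less_mult_iff)

lemma connected_compl_one_side:
  assumes "connected P" "P \<inter> W = {}" "\<not> P \<subseteq> inside W"
  shows "P \<subseteq> outside W"
proof -
  obtain y where y: "y \<in> P" "y \<in> outside W"
    using assms inside_Un_outside[of W] by blast
  show ?thesis
  proof
    fix z assume "z \<in> P"
    then have "connected_component (- W) y z"
      using assms y unfolding connected_component_def by (intro exI[of _ P]) auto
    then show "z \<in> outside W" using outside_same_component y by blast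
  qed
qed

text \<open>A connected piece off \<open>W\<close> lies on one side of \<open>W\<close>. Both sides
  come arbitrarily close to \<open>x\<close>, so the two pieces cannot lie on the same side.\<close>

lemma two_sides:
  assumes PQ: "connected P" "connected Q" "P \<union> Q = ball x r - W" and r: "r > 0"
    and x: "x \<in> closure (inside W)" "x \<in> closure (outside W)"
  shows "P \<subseteq> inside W \<and> Q \<subseteq> outside W \<or> P \<subseteq> outside W \<and> Q \<subseteq> inside W"
proof -
  have W: "P \<inter> W = {}" "Q \<inter> W = {}" using PQ by auto
  have "inside W \<inter> ball x r \<noteq> {}" "outside W \<inter> ball x r \<noteq> {}"
    using x r unfolding closure_approachable by (auto simp: dist_commute disjoint_iff)
  then have "inside W \<inter> (P \<union> Q) \<noteq> {}" "outside W \<inter> (P \<union> Q) \<noteq> {}"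
    using PQ(3) inside_no_overlap[of W] outside_no_overlap[of W] by blast+
  moreover have "inside W \<inter> outside W = {}" by simp
  ultimately show ?thesis
    using connected_compl_one_side[OF PQ(1) W(1)] connected_compl_one_side[OF PQ(2) W(2)]
    by blast
qed

text \<open>Treats vertices and points inside an edge alike: two straight pieces of wall start at
  \<open>x\<close>, and \<open>K\<close> is the rest. The assumption \<open>side\<close> is what the
  Jordan curve theorem contributes.\<close>

locale wall_point =
  fixes W :: "complex set" and x a b :: complex and K :: "complex set"
  assumes W: "W = closed_segment x a \<union> closed_segment x b \<union> K"
    and K: "closed K" "x \<notin> K" and ab: "a \<noteq> x" "b \<noteq> x"
    and meet: "closed_segment x a \<inter> closed_segment x b = {x}"
    and side: "x \<in> closure (inside W)" "x \<in> closure (outside W)"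
begin

lemma near_walls:
  obtains r where "r > 0" "\<And>w. norm w < r \<Longrightarrow>
    x + w \<in> W \<longleftrightarrow> (\<exists>t\<ge>0. w = t *\<^sub>R (a - x)) \<or> (\<exists>t\<ge>0. w = t *\<^sub>R (b - x))"
proof -
  obtain r0 where r0: "r0 > 0" "ball x r0 \<subseteq> - K"
    using K open_contains_ball[of "- K"] by auto
  define r where "r = min r0 (min (norm (a - x)) (norm (b - x)))"
  have ray: "x + w \<in> closed_segment x y \<longleftrightarrow> (\<exists>t\<ge>0. w = t *\<^sub>R (y - x))"
    if "norm w < norm (y - x)" for w y
  proof
    assume "x + w \<in> closed_segment x y"
    then obtain t where "0 \<le> t" "t \<le> 1" "x + w = x + t *\<^sub>R (y - x)" by (rule segment_pointE)
    then show "\<exists>t\<ge>0. w = t *\<^sub>R (y - x)" by auto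
  next
    assume "\<exists>t\<ge>0. w = t *\<^sub>R (y - x)"
    then obtain t where t: "t \<ge> 0" "w = t *\<^sub>R (y - x)" by blast
    then have "t * norm (y - x) < 1 * norm (y - x)" using that by simp
    then have "t \<le> 1" by (metis less_eq_real_def mult_right_less_imp_less norm_ge_zero)
    then show "x + w \<in> closed_segment x y" using t point_on_segment by simp
  qed
  have "x + w \<in> W \<longleftrightarrow> (\<exists>t\<ge>0. w = t *\<^sub>R (a - x)) \<or> (\<exists>t\<ge>0. w = t *\<^sub>R (b - x))"
    if w: "norm w < r" for w
  proof -
    have "x + w \<in> ball x r0" using w by (simp add: r_def dist_norm)
    then have "x + w \<notin> K" using r0 by blast
    then show ?thesis unfolding W using ray[of w a] ray[of w b] w by (auto simp: r_def)
  qed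
  moreover have "r > 0" using r0 ab by (simp add: r_def)
  ultimately show ?thesis using that by blast
qed

text \<open>The two segments leave \<open>x\<close> in opposite directions, so near \<open>x\<close>
  the walls form a diameter of the disc, and the gallery is one of the two half discs, diameter
  included.\<close>

lemma straight_shape:
  assumes cr: "cross (a - x) (b - x) = 0"
  shows "\<exists>r>0. convex ((W \<union> inside W) \<inter> ball x r)"
proof -
  define u where "u = a - x"
  define v where "v = b - x"
  have u: "norm u > 0" "v \<noteq> 0" using ab by (auto simp: u_def v_def)
  have cr: "cross u v = 0" using assms by (simp add: u_def v_def)
  have par: "\<exists>t. w = t *\<^sub>R u" if "cross u w = 0" for w
  proof -
    have "(norm u)\<^sup>2 *\<^sub>R w = (Re u * Re w + Im u * Im w) *\<^sub>R u"
      using that unfolding cmod_power2 cross_def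
      by (auto simp: complex_eq_iff power2_eq_square algebra_simps)
    then have "(1 / (norm u)\<^sup>2) *\<^sub>R (norm u)\<^sup>2 *\<^sub>R w
        = (1 / (norm u)\<^sup>2) *\<^sub>R (Re u * Re w + Im u * Im w) *\<^sub>R u" by (rule arg_cong)
    then have "w = ((Re u * Re w + Im u * Im w) / (norm u)\<^sup>2) *\<^sub>R u"
      using u by simp
    then show ?thesis by blast
  qed
  obtain m where m: "v = m *\<^sub>R u" using par[OF cr] by blast
  \<comment> \<open>With \<open>m > 0\<close> the two segments would share points other than
    \<open>x\<close>.\<close>
  have "m < 0"
  proof (rule ccontr)
    assume "\<not> m < 0"
    moreover have "m \<noteq> 0" using m u by auto
    ultimately have "m > 0" by simp
    define t where "t = min 1 m"
    have t: "t > 0" "t \<le> 1" "t / m \<le> 1" "t / m \<ge> 0" using \<open>m > 0\<close> by (auto simp: t_def)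
    have "x + t *\<^sub>R u \<in> closed_segment x a" using t point_on_segment[of t x a] by (simp add: u_def)
    moreover have "x + t *\<^sub>R u \<in> closed_segment x b"
      using t m \<open>m > 0\<close> point_on_segment[of "t / m" x b] by (simp add: v_def)
    ultimately have "x + t *\<^sub>R u = x" using meet by blast
    then show False using t u by auto
  qed
  obtain r where r: "r > 0" and W': "\<And>w. norm w < r \<Longrightarrow>
      x + w \<in> W \<longleftrightarrow> (\<exists>t\<ge>0. w = t *\<^sub>R u) \<or> (\<exists>t\<ge>0. w = t *\<^sub>R v)"
    using near_walls u_def v_def by metis
  have W0: "z \<in> W \<longleftrightarrow> cross u (z - x) = 0" if "z \<in> ball x r" for z
  proof -
    have n: "norm (z - x) < r" using that by (simp add: dist_norm norm_minus_commute)
    have "(\<exists>t\<ge>0. w = t *\<^sub>R u) \<or> (\<exists>t\<ge>0. w = t *\<^sub>R v)" if w: "cross u w = 0" for w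
    proof -
      obtain t where t: "w = t *\<^sub>R u" using par[OF w] by blast
      show ?thesis
      proof (cases "t \<ge> 0")
        case False
        then have "w = (t / m) *\<^sub>R v" "t / m \<ge> 0" using t m \<open>m < 0\<close> by (auto simp: divide_nonpos_neg)
        then show ?thesis by blast
      qed (use t in blast)
    qed
    moreover have "cross u w = 0" if "(\<exists>t\<ge>0. w = t *\<^sub>R u) \<or> (\<exists>t\<ge>0. w = t *\<^sub>R v)" for w
      using that cr by (auto simp: cross_simps)
    ultimately show ?thesis using W'[OF n] by auto
  qed
  define P where "P = ball x r \<inter> {z. cross u (z - x) > 0}"
  define Q where "Q = ball x r \<inter> {z. cross u (z - x) < 0}"
  have "convex P" "convex Q"
    unfolding P_def Q_def by (intro convex_Int convex_ball convex_halfplane_at[OF cross_linear_right])+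
  moreover have "P \<union> Q = ball x r - W" using W0 by (auto simp: P_def Q_def)
  ultimately have "P \<subseteq> inside W \<and> Q \<subseteq> outside W \<or> P \<subseteq> outside W \<and> Q \<subseteq> inside W"
    using two_sides[OF _ _ _ r side] convex_connected by blast
  then have "(W \<union> inside W) \<inter> ball x r = ball x r \<inter> {z. cross u (z - x) \<ge> 0} \<or>
      (W \<union> inside W) \<inter> ball x r = ball x r \<inter> {z. cross u (z - x) \<le> 0}" (is "?L = ?R1 \<or> ?L = ?R2")
  proof
    assume "P \<subseteq> inside W \<and> Q \<subseteq> outside W"
    then have "z \<in> ?L \<longleftrightarrow> z \<in> ?R1" for z
      using W0[of z] inside_Int_outside[of W] outside_no_overlap[of W] unfolding P_def Q_def
      by (cases "cross u (z - x) = 0"; cases "cross u (z - x) > 0") (auto simp del: inside_Int_outside)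
    then show ?thesis by blast
  next
    assume "P \<subseteq> outside W \<and> Q \<subseteq> inside W"
    then have "z \<in> ?L \<longleftrightarrow> z \<in> ?R2" for z
      using W0[of z] inside_Int_outside[of W] outside_no_overlap[of W] unfolding P_def Q_def
      by (cases "cross u (z - x) = 0"; cases "cross u (z - x) > 0") (auto simp del: inside_Int_outside)
    then show ?thesis by blast
  qed
  moreover have "convex ?R1" "convex ?R2"
    by (intro convex_Int convex_ball convex_halfplane_at[OF cross_linear_right])+
  ultimately show ?thesis using r by metis
qed

text \<open>The walls cut the disc into the convex sector \<open>P\<close> and a union of two half
  discs. If \<open>P\<close> is inside, the gallery is locally \<open>P\<close> together with the
  walls, which is convex; otherwise \<open>P\<close> is exactly the local exterior.\<close>

lemma bent_shape:
  assumes cr: "cross (a - x) (b - x) > 0"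
  shows "(\<exists>r>0. convex ((W \<union> inside W) \<inter> ball x r)) \<or>
    (\<exists>r>0. ball x r - (W \<union> inside W) = ball x r \<inter> sector x (a - x) (b - x))"
proof -
  define u where "u = a - x"
  define v where "v = b - x"
  have cr: "cross u v > 0" using assms by (simp add: u_def v_def)
  obtain r where r: "r > 0" and W': "\<And>w. norm w < r \<Longrightarrow>
      x + w \<in> W \<longleftrightarrow> (\<exists>t\<ge>0. w = t *\<^sub>R u) \<or> (\<exists>t\<ge>0. w = t *\<^sub>R v)"
    using near_walls u_def v_def by metis
  have ray: "(\<exists>t\<ge>0. w = t *\<^sub>R u) \<longleftrightarrow> cross u w = 0 \<and> cross w v \<ge> 0" for w
  proof
    assume *: "cross u w = 0 \<and> cross w v \<ge> 0"
    have "w = (1 / cross u v) *\<^sub>R (cross u v *\<^sub>R w)" using cr by simp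
    also have "\<dots> = (cross w v / cross u v) *\<^sub>R u" using * by (simp add: cross_decompose[of u v w])
    finally show "\<exists>t\<ge>0. w = t *\<^sub>R u" using * cr by (intro exI[of _ "cross w v / cross u v"]) simp
  qed (use cr in \<open>auto simp: cross_simps\<close>)
  have ray': "(\<exists>t\<ge>0. w = t *\<^sub>R v) \<longleftrightarrow> cross w v = 0 \<and> cross u w \<ge> 0" for w
  proof
    assume *: "cross w v = 0 \<and> cross u w \<ge> 0"
    have "w = (1 / cross u v) *\<^sub>R (cross u v *\<^sub>R w)" using cr by simp
    also have "\<dots> = (cross u w / cross u v) *\<^sub>R v" using * by (simp add: cross_decompose[of u v w])
    finally show "\<exists>t\<ge>0. w = t *\<^sub>R v" using * cr by (intro exI[of _ "cross u w / cross u v"]) simp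
  qed (use cr in \<open>auto simp: cross_simps\<close>)
  have W0: "z \<in> W \<longleftrightarrow> cross u (z - x) = 0 \<and> cross (z - x) v \<ge> 0 \<or> cross (z - x) v = 0 \<and> cross u (z - x) \<ge> 0"
    if "z \<in> ball x r" for z
  proof -
    have n: "norm (z - x) < r" using that by (simp add: dist_norm norm_minus_commute)
    show ?thesis using W'[OF n] ray ray' by simp
  qed
  define P where "P = ball x r \<inter> sector x u v"
  define Q1 where "Q1 = ball x r \<inter> {z. cross (z - x) v < 0}"
  define Q2 where "Q2 = ball x r \<inter> {z. cross u (z - x) < 0}"
  have "connected P" unfolding P_def by (intro convex_connected convex_Int convex_ball convex_sector)
  moreover have "connected (Q1 \<union> Q2)"
  proof (rule connected_Un)
    show "connected Q1" "connected Q2" unfolding Q1_def Q2_def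
      by (intro convex_connected convex_Int convex_ball convex_halfplane_at cross_linear_left cross_linear_right)+
    \<comment> \<open>The direction \<open>- (u + v)\<close> points into both half discs, which
      makes their union connected.\<close>
    obtain t where t: "t > 0" "t * norm (u + v) < r" using small_multiple[OF r] by metis
    then have "x - t *\<^sub>R (u + v) \<in> ball x r" using r t by (simp add: dist_norm)
    then have "x - t *\<^sub>R (u + v) \<in> Q1 \<inter> Q2"
      using t cr by (simp add: Q1_def Q2_def cross_simps)
    then show "Q1 \<inter> Q2 \<noteq> {}" by blast
  qed
  moreover have PQ: "P \<union> (Q1 \<union> Q2) = ball x r - W"
    using W0 by (auto simp: P_def Q1_def Q2_def sector_def not_less)
  ultimately have "P \<subseteq> inside W \<and> Q1 \<union> Q2 \<subseteq> outside W \<or> P \<subseteq> outside W \<and> Q1 \<union> Q2 \<subseteq> inside W"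
    using two_sides[OF _ _ _ r side] by blast
  then have "(W \<union> inside W) \<inter> ball x r = ball x r - (Q1 \<union> Q2) \<or> ball x r - (W \<union> inside W) = P"
    using PQ inside_Int_outside[of W] by blast
  moreover have "convex (ball x r - (Q1 \<union> Q2))"
  proof -
    have "ball x r - (Q1 \<union> Q2) = ball x r \<inter> ({z. cross (z - x) v \<ge> 0} \<inter> {z. cross u (z - x) \<ge> 0})"
      by (auto simp: Q1_def Q2_def)
    moreover have "convex \<dots>"
      by (intro convex_Int convex_ball convex_halfplane_at cross_linear_left cross_linear_right)
    ultimately show ?thesis by simp
  qed
  ultimately show ?thesis using r unfolding P_def u_def v_def by metis
qed

end

lemma wall_point_swap: "wall_point W x a b K \<Longrightarrow> wall_point W x b a K"
  unfolding wall_point_def by (auto simp: Int_commute Un_ac)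

lemma wall_point_shape:
  assumes "wall_point W x a b K"
  shows "(\<exists>r>0. convex ((W \<union> inside W) \<inter> ball x r)) \<or>
    (\<exists>r>0. \<exists>u v. cross u v > 0 \<and> ball x r - (W \<union> inside W) = ball x r \<inter> sector x u v)"
proof -
  interpret wall_point W x a b K by fact
  interpret s: wall_point W x b a K by (rule wall_point_swap) fact
  have "cross (b - x) (a - x) = - cross (a - x) (b - x)" by (simp add: cross_def)
  then show ?thesis
    using straight_shape bent_shape s.bent_shape
    by (cases "cross (a - x) (b - x)" "0::real" rule: linorder_cases) (simp | metis neg_0_less_iff_less)+
qed

text \<open>The sector is a cone with apex \<open>x\<close>, so a point of the segment other than
  \<open>x\<close> belongs to it exactly if \<open>y\<close> does.\<close>

lemma star_if_sector_complement:
  assumes x: "x \<in> \<Gamma>" and D: "ball x r - \<Gamma> = ball x r \<inter> sector x u v" and y: "y \<in> \<Gamma> \<inter> ball x r"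
  shows "closed_segment x y \<subseteq> \<Gamma>"
proof
  fix z assume z: "z \<in> closed_segment x y"
  then obtain t where t: "0 \<le> t" "t \<le> 1" "z = x + t *\<^sub>R (y - x)" by (rule segment_pointE)
  have zb: "z \<in> ball x r"
  proof -
    have "dist x y < r" using y by simp
    then have "x \<in> ball x r" using zero_le_dist[of x y] by (simp del: zero_le_dist)
    then show ?thesis using z y closed_segment_subset[OF _ _ convex_ball, of x x r y] by blast
  qed
  show "z \<in> \<Gamma>"
  proof (cases "t = 0")
    case False
    then have "z \<in> sector x u v \<longleftrightarrow> y \<in> sector x u v"
      using t sector_dilate[of t x "y - x" u v] by simp
    then show ?thesis using D y zb by blast
  qed (use t x in simp)
qed

text \<open>
  \<open>D\<close> and \<open>- D\<close> cover all directions and overlap in a nonempty open set.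
\<close>

lemma measure_directions_gt_pi:
  fixes u v :: complex
  assumes cr: "cross u v > 0"
  defines "D \<equiv> {w. cross w v < 0 \<or> cross u w < 0}"
  shows "measure lebesgue {\<theta> \<in> {0..<2*pi}. cis \<theta> \<in> D} > pi"
proof -
  define D' where "D' = uminus -` D"
  have oD: "open D"
    unfolding D_def Collect_disj_eq by (intro open_Un open_Collect_less continuous_intros)
  have oD': "open D'" unfolding D'_def by (intro open_vimage oD continuous_intros)
  have ocis: "open (cis -` X)" if "open X" for X
    by (intro open_vimage that) (simp add: continuous_on_cis)
  have borel: "I \<inter> cis -` X \<in> lmeasurable" if "I \<in> lmeasurable" "open X" for I X
    using that ocis by (intro fmeasurable_Int_fmeasurable) (auto intro: borel_open)
  \<comment> \<open>Directions are folded modulo \<open>pi\<close>: \<open>T2\<close> holds the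
    angles whose opposite direction lies in \<open>D\<close>. The measure sought is the sum of the
    measures of \<open>T1\<close> and \<open>T2\<close>, that is, \<open>pi\<close> plus the measure
    of their overlap.\<close>
  define T1 where "T1 = {0..<pi} \<inter> cis -` D"
  define T2 where "T2 = {0..<pi} \<inter> cis -` D'"
  have half: "{0..<pi} \<in> lmeasurable" by (intro bounded_set_imp_lmeasurable) auto
  have m: "T1 \<in> lmeasurable" "T2 \<in> lmeasurable"
    unfolding T1_def T2_def using borel half oD oD' by auto
  have split: "{\<theta> \<in> {0..<2*pi}. cis \<theta> \<in> D} = T1 \<union> (+) pi ` T2"
  proof (intro set_eqI iffI)
    fix \<theta> assume \<theta>: "\<theta> \<in> {\<theta> \<in> {0..<2*pi}. cis \<theta> \<in> D}"
    show "\<theta> \<in> T1 \<union> (+) pi ` T2"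
    proof (cases "\<theta> < pi")
      case False
      have "cis (\<theta> - pi) = - cis \<theta>" by (simp add: complex_eq_iff)
      then have "\<theta> - pi \<in> T2" using \<theta> False by (auto simp: T2_def D'_def)
      then have "pi + (\<theta> - pi) \<in> (+) pi ` T2" by (rule imageI)
      then show ?thesis by simp
    qed (use \<theta> in \<open>auto simp: T1_def\<close>)
  next
    fix \<theta> assume "\<theta> \<in> T1 \<union> (+) pi ` T2"
    moreover have "cis (pi + \<theta>) = - cis \<theta>" for \<theta> by (simp add: complex_eq_iff)
    ultimately show "\<theta> \<in> {\<theta> \<in> {0..<2*pi}. cis \<theta> \<in> D}"
      by (auto simp: T1_def T2_def D'_def)
  qed
  have m2: "(+) pi ` T2 \<in> lmeasurable" using m by (intro measurable_translation)
  have "T1 \<inter> (+) pi ` T2 = {}" by (auto simp: T1_def T2_def)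
  then have meas: "measure lebesgue {\<theta> \<in> {0..<2*pi}. cis \<theta> \<in> D} = measure lebesgue T1 + measure lebesgue T2"
    unfolding split using measure_Un3[OF m(1) m2] by (simp add: measure_translation)
  have un: "T1 \<union> T2 = {0..<pi}"
  proof -
    have "cis \<theta> \<in> D \<or> cis \<theta> \<in> D'" for \<theta>
    proof (rule ccontr)
      assume "\<not> ?thesis"
      then have "cross (cis \<theta>) v = 0" "cross u (cis \<theta>) = 0" by (auto simp: D_def D'_def cross_simps)
      then have "cross u v *\<^sub>R cis \<theta> = 0" by (simp add: cross_decompose[of u v "cis \<theta>"])
      then show False using cr by simp
    qed
    then show ?thesis by (auto simp: T1_def T2_def)
  qed
  have "measure lebesgue (T1 \<inter> T2) > 0"
  proof -
    \<comment> \<open>\<open>u - v\<close> violates the sector condition for \<open>u\<close> and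
      its negative violates that for \<open>v\<close>, so both lie in \<open>D\<close>.\<close>
    define w where "w = u - v"
    have w: "w \<in> D \<inter> D'" using cr by (auto simp: w_def D_def D'_def cross_simps)
    then have w0: "w \<noteq> 0" by (auto simp: D_def cross_simps)
    have sc: "t *\<^sub>R w \<in> D \<inter> D'" if "t \<noteq> 0" for t
      using w that by (cases "t > 0") (auto simp: D_def D'_def cross_simps mult_less_0_iff zero_less_mult_iff)
    have cA: "cis (Arg w) = (1 / norm w) *\<^sub>R w"
      using cis_Arg[OF w0] by (simp add: sgn_div_norm divide_inverse)
    obtain \<theta> where \<theta>: "0 \<le> \<theta>" "\<theta> < pi" "cis \<theta> \<in> D \<inter> D'"
    proof (cases "0 \<le> Arg w \<and> Arg w < pi")
      case True
      then show ?thesis using that[of "Arg w"] sc[of "1 / norm w"] cA w0 by simp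
    next
      case False
      define s where "s = (if Arg w < 0 then pi else - pi)"
      have "Arg w \<le> pi" "- pi < Arg w" using Arg_bounded by auto
      then have "0 \<le> Arg w + s" "Arg w + s < pi" using False by (auto simp: s_def)
      moreover have "cis (Arg w + s) = - cis (Arg w)" by (auto simp: s_def complex_eq_iff)
      then have "cis (Arg w + s) = (- 1 / norm w) *\<^sub>R w" using cA by simp
      then have "cis (Arg w + s) \<in> D \<inter> D'" using sc[of "- 1 / norm w"] w0 by simp
      ultimately show ?thesis using that by blast
    qed
    have "open (cis -` (D \<inter> D'))" using ocis oD oD' by blast
    then obtain e where e: "e > 0" "ball \<theta> e \<subseteq> cis -` (D \<inter> D')"
      using \<theta>(3) open_contains_ball by blast
    define \<theta>' where "\<theta>' = min (\<theta> + e / 2) ((\<theta> + pi) / 2)"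
    have \<theta>': "\<theta> < \<theta>'" "\<theta>' < \<theta> + e" "\<theta>' < pi" using e \<theta> by (auto simp: \<theta>'_def min_def)
    have "{\<theta>..\<theta>'} \<subseteq> T1 \<inter> T2"
    proof
      fix x assume x: "x \<in> {\<theta>..\<theta>'}"
      then have "x \<in> ball \<theta> e" using \<theta>' by (simp add: dist_real_def)
      then have "cis x \<in> D \<inter> D'" using e by blast
      then show "x \<in> T1 \<inter> T2" using x \<theta> \<theta>' by (auto simp: T1_def T2_def)
    qed
    then have "measure lebesgue {\<theta>..\<theta>'} \<le> measure lebesgue (T1 \<inter> T2)"
      using m by (intro measure_mono_fmeasurable) auto
    then show ?thesis using \<theta>' by simp
  qed
  moreover have "measure lebesgue {0..<pi} = pi" by simp
  ultimately show ?thesis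
    using measure_Un3[OF m] unfolding meas un by simp
qed

text \<open>The directions measured by \<open>interior_angle\<close> are exactly those outside the
  closed sector, to which \<open>measure_directions_gt_pi\<close> applies.\<close>

lemma interior_angle_gt_pi:
  assumes r: "r > 0" and cr: "cross u v > 0"
    and D: "ball (p ! i) r - gallery p = ball (p ! i) r \<inter> sector (p ! i) u v"
  shows "interior_angle p i > pi"
proof -
  define x where "x = p ! i"
  define D' where "D' = {w. cross w v < 0 \<or> cross u w < 0}"
  have D: "ball x r - gallery p = ball x r \<inter> sector x u v" using D by (simp add: x_def)
  have oD': "open {z. z - x \<in> D'}"
  proof -
    have "{z. z - x \<in> D'} = {z. cross (z - x) v < 0} \<union> {z. cross u (z - x) < 0}"
      by (auto simp: D'_def)
    then show ?thesis by (auto intro!: open_Un open_Collect_less continuous_intros)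
  qed
  have sc: "t *\<^sub>R w \<in> D' \<longleftrightarrow> w \<in> D'" if "t > 0" for t w
    using that by (simp add: D'_def cross_simps mult_less_0_iff)
  have "(\<exists>\<epsilon>>0. \<forall>t. 0 < t \<and> t < \<epsilon> \<longrightarrow> x + complex_of_real t * cis \<theta> \<in> interior (gallery p)) \<longleftrightarrow> cis \<theta> \<in> D'" for \<theta>
  proof
    assume "\<exists>\<epsilon>>0. \<forall>t. 0 < t \<and> t < \<epsilon> \<longrightarrow> x + complex_of_real t * cis \<theta> \<in> interior (gallery p)"
    then obtain \<epsilon> where \<epsilon>: "\<epsilon> > 0"
      "\<And>t. 0 < t \<Longrightarrow> t < \<epsilon> \<Longrightarrow> x + complex_of_real t * cis \<theta> \<in> interior (gallery p)" by blast
    define t where "t = min \<epsilon> r / 2"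
    have t: "0 < t" "t < \<epsilon>" "t < r" using \<epsilon>(1) r by (auto simp: t_def)
    define y where "y = x + t *\<^sub>R cis \<theta>"
    have "y \<in> interior (gallery p)" using \<epsilon>(2)[OF t(1,2)] by (simp add: y_def scaleR_conv_of_real)
    moreover have "y \<in> ball x r" using t by (simp add: y_def dist_norm)
    ultimately have "y \<in> interior (gallery p) \<inter> ball x r" by blast
    then obtain e where e: "e > 0" "ball y e \<subseteq> interior (gallery p) \<inter> ball x r"
      using open_contains_ball[of "interior (gallery p) \<inter> ball x r"] by (metis open_Int open_ball open_interior)
    \<comment> \<open>A direction along a wall must be excluded as well. Pushing \<open>y\<close> by
      a small multiple of \<open>u + v\<close> moves a point of the closed sector into the open one,
      that is, into the exterior.\<close>
    obtain \<delta> where \<delta>: "\<delta> > 0" "\<delta> * norm (u + v) < e" using small_multiple[OF e(1)] by metis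
    then have "y + \<delta> *\<^sub>R (u + v) \<in> ball y e" using e \<delta> by (simp add: dist_norm)
    then have "y + \<delta> *\<^sub>R (u + v) \<in> gallery p \<inter> ball x r" using e interior_subset by blast
    then have ns: "y + \<delta> *\<^sub>R (u + v) \<notin> sector x u v" using D by blast
    show "cis \<theta> \<in> D'"
    proof (rule ccontr)
      assume "cis \<theta> \<notin> D'"
      then have "cross (cis \<theta>) v \<ge> 0" "cross u (cis \<theta>) \<ge> 0" by (auto simp: D'_def)
      then have "y + \<delta> *\<^sub>R (u + v) \<in> sector x u v"
        using t \<delta> cr by (auto simp: sector_def y_def cross_simps add_nonneg_pos)
      then show False using ns by simp
    qed
  next
    assume c: "cis \<theta> \<in> D'"
    have sub: "ball x r \<inter> {z. z - x \<in> D'} \<subseteq> interior (gallery p)"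
    proof (rule interior_maximal)
      show "open (ball x r \<inter> {z. z - x \<in> D'})" using oD' by blast
      show "ball x r \<inter> {z. z - x \<in> D'} \<subseteq> gallery p"
      proof
        fix z assume z: "z \<in> ball x r \<inter> {z. z - x \<in> D'}"
        then have "z \<notin> sector x u v" by (auto simp: sector_def D'_def)
        then show "z \<in> gallery p" using D z by blast
      qed
    qed
    have "x + complex_of_real t * cis \<theta> \<in> interior (gallery p)" if "0 < t" "t < r" for t
    proof -
      have "t *\<^sub>R cis \<theta> \<in> D'" using sc c that by simp
      then have "x + complex_of_real t * cis \<theta> \<in> ball x r \<inter> {z. z - x \<in> D'}"
        using that by (simp add: dist_norm norm_mult scaleR_conv_of_real)
      then show ?thesis using sub by blast
    qed
    then show "\<exists>\<epsilon>>0. \<forall>t. 0 < t \<and> t < \<epsilon> \<longrightarrow> x + complex_of_real t * cis \<theta> \<in> interior (gallery p)"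
      using r by blast
  qed
  then show ?thesis
    using measure_directions_gt_pi[OF cr] unfolding interior_angle_def x_def[symmetric] D'_def by simp
qed

section \<open>Polygons\<close>

text \<open>Adding one edge at a time allows an induction showing that the path is an arc; the
  closing edge is joined only in \<open>walls_loop\<close>.\<close>

primrec boundary_path :: "complex list \<Rightarrow> nat \<Rightarrow> real \<Rightarrow> complex" where
  "boundary_path p 0 = linepath (p ! 0) (p ! 1)"
| "boundary_path p (Suc k) = boundary_path p k +++ linepath (p ! Suc k) (p ! (Suc (Suc k) mod length p))"

context
  fixes p :: "complex list"
  assumes sp: "simple_polygon p"
begin

lemma length_ge_3: "length p \<ge> 3" and distinct_vertices: "distinct p"
  using sp by (auto simp: simple_polygon_def)

lemma edge_meet_next:
  "i < length p \<Longrightarrow> edge p i \<inter> edge p (Suc i mod length p) = {p ! (Suc i mod length p)}"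
proof -
  assume i: "i < length p"
  define j where "j = Suc i mod length p"
  have j: "j < length p" unfolding j_def using i by (intro mod_less_divisor) auto
  have "i \<noteq> j" using i length_ge_3 by (auto simp: j_def mod_Suc split: if_splits)
  then show ?thesis using sp i j unfolding simple_polygon_def j_def by metis
qed

lemma edge_meet_apart:
  assumes "i < length p" "j < length p" "i \<noteq> j" "j \<noteq> Suc i mod length p" "i \<noteq> Suc j mod length p"
  shows "edge p i \<inter> edge p j = {}"
  using sp assms unfolding simple_polygon_def by metis

lemma vertex_eq_iff: "i < length p \<Longrightarrow> j < length p \<Longrightarrow> p ! i = p ! j \<longleftrightarrow> i = j"
  using distinct_vertices by (simp add: nth_eq_iff_index_eq)

lemma edge_ends_distinct: "i < length p \<Longrightarrow> p ! i \<noteq> p ! (Suc i mod length p)"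
  using length_ge_3 by (subst vertex_eq_iff) (auto simp: mod_Suc split: if_splits)

lemma boundary_path:
  "Suc k < length p \<Longrightarrow> arc (boundary_path p k) \<and> pathstart (boundary_path p k) = p ! 0 \<and>
     pathfinish (boundary_path p k) = p ! Suc k \<and> path_image (boundary_path p k) = (\<Union>i\<le>k. edge p i)"
proof (induction k)
  case 0
  have "0 < length p" using 0 by linarith
  then have "p ! 0 \<noteq> p ! 1" using edge_ends_distinct[of 0] 0 by simp
  then show ?case using 0 by (simp add: edge_def)
next
  case (Suc k)
  then have IH: "arc (boundary_path p k)" "pathstart (boundary_path p k) = p ! 0"
     "pathfinish (boundary_path p k) = p ! Suc k" "path_image (boundary_path p k) = (\<Union>i\<le>k. edge p i)"
    by auto
  have ne: "p ! Suc k \<noteq> p ! Suc (Suc k)" using edge_ends_distinct[of "Suc k"] Suc.prems by simp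
  have "(\<Union>i\<le>k. edge p i) \<inter> edge p (Suc k) \<subseteq> {p ! Suc k}"
  proof -
    have "edge p i \<inter> edge p (Suc k) \<subseteq> {p ! Suc k}" if "i \<le> k" for i
    proof (cases "i = k")
      case True
      then show ?thesis using edge_meet_next[of k] Suc.prems by simp
    next
      case False
      then have "edge p i \<inter> edge p (Suc k) = {}"
        using that Suc.prems by (intro edge_meet_apart) auto
      then show ?thesis by simp
    qed
    then show ?thesis by blast
  qed
  moreover have e: "edge p (Suc k) = closed_segment (p ! Suc k) (p ! Suc (Suc k))"
    using Suc.prems by (simp add: edge_def)
  ultimately have "arc (boundary_path p (Suc k))"
    using IH ne Suc.prems by (auto intro!: arc_join)
  moreover have "path_image (boundary_path p (Suc k)) = (\<Union>i\<le>Suc k. edge p i)"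
    using IH e Suc.prems by (simp add: path_image_join atMost_Suc Un_commute)
  ultimately show ?case using IH Suc.prems by simp
qed

lemma walls_loop:
  obtains c where "simple_path c" "pathfinish c = pathstart c" "path_image c = walls p"
proof -
  \<comment> \<open>\<open>boundary_path p n\<close> uses the edges up to index \<open>n\<close>, so
    just the edge of index \<open>Suc n\<close> remains to close the loop.\<close>
  define n where "n = length p - 2"
  have n: "length p = Suc (Suc n)" "n \<ge> 1" using length_ge_3 by (auto simp: n_def)
  have g: "arc (boundary_path p n)" "pathstart (boundary_path p n) = p ! 0"
     "pathfinish (boundary_path p n) = p ! Suc n" "path_image (boundary_path p n) = (\<Union>i\<le>n. edge p i)"
    using boundary_path[of n] n by auto
  define l where "l = linepath (p ! Suc n) (p ! 0)"
  have pl: "path_image l = edge p (Suc n)" by (simp add: l_def edge_def n)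
  have "p ! Suc n \<noteq> p ! 0" using n by (subst vertex_eq_iff) auto
  then have "arc l" by (simp add: l_def)
  moreover have "(\<Union>i\<le>n. edge p i) \<inter> edge p (Suc n) \<subseteq> {p ! 0, p ! Suc n}"
  proof -
    have "edge p i \<inter> edge p (Suc n) \<subseteq> {p ! 0, p ! Suc n}" if i: "i \<le> n" for i
    proof -
      consider "i = n" | "i = 0" | "0 < i" "i < n"
        using i by fastforce
      then show ?thesis
      proof cases
        case 1
        then show ?thesis using edge_meet_next[of n] n by simp
      next
        case 2
        then show ?thesis using edge_meet_next[of "Suc n"] n by (simp add: Int_commute)
      next
        case 3
        then have "edge p i \<inter> edge p (Suc n) = {}" using n by (intro edge_meet_apart) auto
        then show ?thesis by simp
      qed
    qed
    then show ?thesis by blast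
  qed
  ultimately have "simple_path (boundary_path p n +++ l)"
    using g pl by (intro simple_path_join_loop) (auto simp: l_def)
  moreover have "path_image (boundary_path p n +++ l) = walls p"
  proof -
    have "path_image (boundary_path p n +++ l) = (\<Union>i\<le>n. edge p i) \<union> edge p (Suc n)"
      using g pl by (simp add: path_image_join l_def)
    also have "\<dots> = walls p" unfolding walls_def n by (simp add: lessThan_Suc_atMost atMost_Suc Un_commute)
    finally show ?thesis .
  qed
  ultimately show ?thesis using that[of "boundary_path p n +++ l"] g by (simp add: l_def)
qed

lemma
  shows open_inside_walls: "open (inside (walls p))"
    and connected_inside_walls: "connected (inside (walls p))"
    and connected_outside_walls: "connected (outside (walls p))"
    and bounded_inside_walls: "bounded (inside (walls p))"
    and unbounded_outside_walls: "\<not> bounded (outside (walls p))"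
    and frontier_inside_walls: "frontier (inside (walls p)) = walls p"
    and frontier_outside_walls: "frontier (outside (walls p)) = walls p"
  using walls_loop Jordan_inside_outside by metis+

lemma closed_edge: "closed (edge p i)"
  by (simp add: edge_def)

lemma compact_walls: "compact (walls p)"
  unfolding walls_def edge_def by (intro compact_UN) auto

lemma walls_in_closures:
  assumes "x \<in> walls p"
  shows "x \<in> closure (inside (walls p))" "x \<in> closure (outside (walls p))"
  using assms frontier_inside_walls frontier_outside_walls by (auto simp: frontier_def)

lemma wall_point_vertex:
  assumes j: "j < length p"
  shows "\<exists>a b K. wall_point (walls p) (p ! j) a b K"
proof -
  define n where "n = length p"
  have n: "n \<ge> 3" using length_ge_3 by (simp add: n_def)
  define i where "i = (if j = 0 then n - 1 else j - 1)"
  have i: "i < n" "Suc i mod n = j" "i \<noteq> j" using j n by (auto simp: i_def n_def)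
  define K where "K = (\<Union>k\<in>{..<n} - {i, j}. edge p k)"
  have ej: "edge p j = closed_segment (p ! j) (p ! (Suc j mod n))" by (simp add: edge_def n_def)
  have ei: "edge p i = closed_segment (p ! j) (p ! i)"
    using i by (simp add: edge_def n_def closed_segment_commute)
  have mem: "p ! j \<in> edge p j" by (simp add: ej)
  have "wall_point (walls p) (p ! j) (p ! (Suc j mod n)) (p ! i) K"
  proof
    show "walls p = closed_segment (p ! j) (p ! (Suc j mod n)) \<union> closed_segment (p ! j) (p ! i) \<union> K"
      unfolding ej[symmetric] ei[symmetric] K_def walls_def n_def[symmetric]
      using i j by (auto simp: n_def)
    show "closed K" unfolding K_def by (intro closed_UN) (auto simp: closed_edge)
    show "p ! j \<notin> K"
    proof
      assume "p ! j \<in> K"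
      then obtain k where k: "k < n" "k \<noteq> i" "k \<noteq> j" "p ! j \<in> edge p k" by (auto simp: K_def)
      have "edge p j \<inter> edge p k \<noteq> {}" using k mem by blast
      \<comment> \<open>A third edge through \<open>p ! j\<close> would be adjacent to edge
        \<open>j\<close>. The next edge meets it only in \<open>p ! k\<close>, and the previous one
        is edge \<open>i\<close>.\<close>
      then consider "k = Suc j mod n" | "j = Suc k mod n"
        using edge_meet_apart[of j k] k j by (auto simp: n_def)
      then show False
      proof cases
        case 1
        then have "p ! j \<in> {p ! k}" using edge_meet_next[OF j] k mem by (auto simp: n_def)
        then show False using vertex_eq_iff[of j k] k j by (simp add: n_def)
      next
        case 2
        then have "Suc k mod n = Suc i mod n" using i by simp
        then show False using k i by (auto simp: mod_Suc split: if_splits)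
      qed
    qed
    show "p ! (Suc j mod n) \<noteq> p ! j" using edge_ends_distinct[OF j] by (simp add: n_def)
    show "p ! i \<noteq> p ! j" using vertex_eq_iff[of i j] i j by (simp add: n_def)
    show "closed_segment (p ! j) (p ! (Suc j mod n)) \<inter> closed_segment (p ! j) (p ! i) = {p ! j}"
      unfolding ej[symmetric] ei[symmetric]
      using edge_meet_next[of i] i by (simp add: n_def Int_commute)
    have "p ! j \<in> walls p" using j mem by (auto simp: walls_def)
    then show "p ! j \<in> closure (inside (walls p))" "p ! j \<in> closure (outside (walls p))"
      by (rule walls_in_closures)+
  qed
  then show ?thesis by blast
qed

lemma wall_point_edge:
  assumes i: "i < length p" and x: "x \<in> edge p i" "x \<notin> set p"
  shows "\<exists>a b K. wall_point (walls p) x a b K \<and> cross (a - x) (b - x) = 0"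
proof -
  define a where "a = p ! i"
  define b where "b = p ! (Suc i mod length p)"
  have e: "edge p i = closed_segment a b" by (simp add: edge_def a_def b_def)
  have "Suc i mod length p < length p" using i by (intro mod_less_divisor) auto
  then have ab: "a \<noteq> x" "b \<noteq> x" using x i by (auto simp: a_def b_def)
  define K where "K = (\<Union>k\<in>{..<length p} - {i}. edge p k)"
  have "x \<in> closed_segment a b" using x e by simp
  then have seg: "closed_segment x a \<union> closed_segment x b = closed_segment a b"
    "closed_segment x a \<inter> closed_segment x b = {x}"
    using Un_closed_segment Int_closed_segment by (metis closed_segment_commute)+
  have "wall_point (walls p) x a b K"
  proof
    show "walls p = closed_segment x a \<union> closed_segment x b \<union> K"
      unfolding seg e[symmetric] K_def walls_def using i by auto
    show "closed K" unfolding K_def by (intro closed_UN) (auto simp: closed_edge)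
    show "x \<notin> K"
    proof
      assume "x \<in> K"
      then obtain k where k: "k < length p" "k \<noteq> i" "x \<in> edge p k" by (auto simp: K_def)
      have "edge p i \<inter> edge p k \<noteq> {}" using k x by blast
      then consider "k = Suc i mod length p" | "i = Suc k mod length p"
        using edge_meet_apart[of i k] k i by auto
      then show False
      proof cases
        case 1
        then have "x = p ! k" using edge_meet_next[OF i] k x by auto
        then show False using k x by simp
      next
        case 2
        then have "x = p ! i" using edge_meet_next[OF k(1)] k x by auto
        then show False using i x by simp
      qed
    qed
    have "x \<in> walls p" using i x by (auto simp: walls_def)
    then show "x \<in> closure (inside (walls p))" "x \<in> closure (outside (walls p))"
      by (rule walls_in_closures)+
  qed (use ab seg in auto)
  moreover have "cross (a - x) (b - x) = 0"
  proof -
    obtain t where t: "x = a + t *\<^sub>R (b - a)" using x e segment_pointE by metis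
    have "a - x = (- t) *\<^sub>R (b - a)" "b - x = (1 - t) *\<^sub>R (b - a)"
      unfolding t by (simp_all add: algebra_simps)
    then show ?thesis by (simp only: cross_simps(3,8,9) mult_zero_right)
  qed
  ultimately show ?thesis by blast
qed

section \<open>The gallery as a region without holes\<close>

lemma gallery_shape:
  assumes "x \<in> gallery p"
  shows "(\<exists>r>0. convex (gallery p \<inter> ball x r)) \<or>
    (\<exists>r>0. \<exists>u v. cross u v > 0 \<and> ball x r - gallery p = ball x r \<inter> sector x u v)"
proof (cases "x \<in> walls p")
  case False
  then have "x \<in> inside (walls p)" using assms by (simp add: gallery_def)
  then obtain r where "r > 0" "ball x r \<subseteq> inside (walls p)"
    using open_inside_walls open_contains_ball by blast
  then have "gallery p \<inter> ball x r = ball x r" by (auto simp: gallery_def)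
  then show ?thesis using \<open>r > 0\<close> convex_ball by metis
next
  case True
  have "\<exists>a b K. wall_point (walls p) x a b K"
    using True wall_point_edge wall_point_vertex unfolding walls_def
    by (metis UN_E in_set_conv_nth lessThan_iff)
  then show ?thesis unfolding gallery_def using wall_point_shape by blast
qed

text \<open>Points off the walls and points inside an edge have convex neighbourhoods, so
  \<open>x\<close> is a vertex. There the exterior is locally a sector, which makes the interior
  angle exceed \<open>pi\<close>.\<close>

lemma reflex_corner_if_not_convex:
  assumes x: "x \<in> gallery p" and nc: "\<not> (\<exists>r>0. convex (gallery p \<inter> ball x r))"
  shows "x \<in> (!) p ` reflex_corners p"
proof -
  obtain r u v where r: "r > 0" "cross u v > 0" "ball x r - gallery p = ball x r \<inter> sector x u v"
    using gallery_shape[OF x] nc by blast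
  have "x \<in> set p"
  proof (rule ccontr)
    assume xp: "x \<notin> set p"
    have "x \<in> walls p"
    proof (rule ccontr)
      assume "x \<notin> walls p"
      then have "x \<in> inside (walls p)" using x by (simp add: gallery_def)
      then obtain r where "r > 0" "ball x r \<subseteq> inside (walls p)"
        using open_inside_walls open_contains_ball by blast
      then have "gallery p \<inter> ball x r = ball x r" by (auto simp: gallery_def)
      then show False using nc \<open>r > 0\<close> convex_ball by metis
    qed
    then obtain i where "i < length p" "x \<in> edge p i" by (auto simp: walls_def)
    then obtain a b K where "wall_point (walls p) x a b K" "cross (a - x) (b - x) = 0"
      using wall_point_edge xp by blast
    then show False using wall_point.straight_shape nc unfolding gallery_def by blast
  qed
  then obtain i where i: "i < length p" "x = p ! i" by (auto simp: in_set_conv_nth)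
  have "interior_angle p i > pi"
    using interior_angle_gt_pi[OF r(1,2)] r(3) i by simp
  then show ?thesis using i by (auto simp: reflex_corners_def)
qed

lemma gallery_eq_compl: "gallery p = - outside (walls p)"
  by (simp add: gallery_def union_with_inside)

lemma compact_gallery: "compact (gallery p)"
proof -
  have "closed (gallery p)"
    unfolding gallery_eq_compl using compact_walls by (simp add: open_outside compact_imp_closed closed_Compl)
  moreover have "bounded (gallery p)"
    using compact_walls bounded_inside_walls by (simp add: gallery_def compact_imp_bounded)
  ultimately show ?thesis by (simp add: compact_eq_bounded_closed)
qed

lemma connected_gallery: "connected (gallery p)"
proof -
  have "gallery p = closure (inside (walls p))"
    unfolding closure_Un_frontier frontier_inside_walls gallery_def by (rule Un_commute)
  then show ?thesis using connected_inside_walls connected_imp_connected_closure by metis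
qed

text \<open>The complement of the gallery is \<open>outside (walls p)\<close>, which is connected
  and unbounded.\<close>

lemma inside_gallery: "inside (gallery p) = {}"
proof -
  have "\<not> bounded (connected_component_set (- gallery p) x)" if "x \<notin> gallery p" for x
  proof -
    have "connected_component_set (- gallery p) x = outside (walls p)"
      using that connected_outside_walls connected_component_eq_self[of "outside (walls p)" x]
      by (simp add: gallery_eq_compl)
    then show ?thesis using unbounded_outside_walls by simp
  qed
  then show ?thesis by (auto simp: inside_def)
qed

lemma gallery_region:
  "hole_free_region (gallery p) {x \<in> gallery p. \<not> (\<exists>r>0. convex (gallery p \<inter> ball x r))}"
proof
  show "compact (gallery p)" "connected (gallery p)" "inside (gallery p) = {}"
    by (fact compact_gallery connected_gallery inside_gallery)+
next
  fix x assume x: "x \<in> gallery p"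
  show "\<exists>r>0. \<forall>y\<in>gallery p \<inter> ball x r. closed_segment x y \<subseteq> gallery p"
    using gallery_shape[OF x]
  proof
    assume "\<exists>r>0. convex (gallery p \<inter> ball x r)"
    then obtain r where r: "r > 0" "convex (gallery p \<inter> ball x r)" by blast
    then have "closed_segment x y \<subseteq> gallery p" if "y \<in> gallery p \<inter> ball x r" for y
      using closed_segment_subset[OF _ that r(2), of x] x by auto
    then show ?thesis using r by blast
  next
    assume "\<exists>r>0. \<exists>u v. cross u v > 0 \<and> ball x r - gallery p = ball x r \<inter> sector x u v"
    then show ?thesis using star_if_sector_complement[OF x] by blast
  qed
next
  fix x assume x: "x \<in> {x \<in> gallery p. \<not> (\<exists>r>0. convex (gallery p \<inter> ball x r))}"
  then obtain r u v where "r > 0" "ball x r - gallery p = ball x r \<inter> sector x u v"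
    using gallery_shape by blast
  then show "\<exists>r>0. convex (ball x r - gallery p)"
    using convex_Int[OF convex_ball convex_sector] by metis
qed blast

end

theorem theorem1:
  fixes p :: "complex list"
  assumes "simple_polygon p"
    and "card (reflex_corners p) \<le> 2"
  shows "normal_gallery p"
proof -
  \<comment> \<open>Angles enter only through the inclusion of \<open>S\<close> in the set of reflex
    corners, which bounds its size by two.\<close>
  define S where "S = {x \<in> gallery p. \<not> (\<exists>r>0. convex (gallery p \<inter> ball x r))}"
  interpret hole_free_region "gallery p" S
    unfolding S_def by (rule gallery_region[OF assms(1)])
  have fin: "finite (reflex_corners p)" by (simp add: reflex_corners_def)
  have sub: "S \<subseteq> (!) p ` reflex_corners p"
    using reflex_corner_if_not_convex[OF assms(1)] by (auto simp: S_def)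
  have finS: "finite S" using sub fin finite_surj by blast
  have "card S \<le> card (reflex_corners p)"
    using surj_card_le[OF fin sub] .
  then have cardS: "card S \<le> 2" using assms(2) by linarith
  \<comment> \<open>Hence guards who cover the walls cover the frontier, and a gallery point off the
    walls is interior, as \<open>covered_interior\<close> requires.\<close>
  have int: "inside (walls p) \<subseteq> interior (gallery p)"
    using open_inside_walls[OF assms(1)] by (intro interior_maximal) (auto simp: gallery_def)
  have "frontier (gallery p) = gallery p - interior (gallery p)"
    using compact_imp_closed[OF compact] by (simp add: frontier_def)
  then have fr: "frontier (gallery p) \<subseteq> walls p" using int unfolding gallery_def by blast
  have "config_covers (gallery p) F (gallery p)"
    if F: "finite F" "config_covers (gallery p) F (walls p)" for F
    unfolding config_covers_def visually_covers_def
  proof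
    fix A assume A: "A \<in> gallery p"
    show "\<exists>G\<in>F. closed_segment G A \<subseteq> gallery p"
    proof (cases "A \<in> walls p")
      case True
      then show ?thesis using F by (auto simp: config_covers_def visually_covers_def)
    next
      case False
      then have "A \<in> interior (gallery p)" using A int by (auto simp: gallery_def)
      moreover have "\<exists>G\<in>F. sees G B" if "B \<in> frontier (gallery p)" for B
        using F fr that by (auto simp: config_covers_def visually_covers_def sees_def)
      ultimately show ?thesis
        using covered_interior[OF finS cardS F(1)] by (auto simp: sees_def)
    qed
  qed
  then show ?thesis by (auto simp: normal_gallery_def)
qed

end
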